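(* The modular Weil representation $\omega_{\psi,W}^R$ on $W$ associated to $\psi$ is smooth and admissible.
   Context: $F$ is a field which is either finite of characteristic $p$ or non-archimedean local of residual characteristic $p$, of characteristic different from $2$; $(W,\langle\,,\rangle)$ is a finite-dimensional symplectic space over $F$; $R$ is a field with a fixed non-trivial smooth character $\psi:F\to R^\times$ (so $\mathrm{char}\,R\neq p$). Heisenberg group: $H=W\times F$ with $(w,t)(w',t')=(w+w',t+t'+\tfrac12\langle w,w'\rangle)$, centre $F=\{(0,t)\}$. $(\rho_\psi,S)$ is a model of the unique (up to isomorphism) irreducible smooth $R$-representation of $H$ with central character $\psi$. $\widetilde{\mathrm{Sp}}_{\psi,S}^R(W)=\{(g,M)\in\mathrm{Sp}(W)\times\mathrm{GL}_R(S): M\rho_\psi(w,t)M^{-1}=\rho_\psi(g^{-1}w,t)\ \forall(w,t)\in H\}$, a topological central extension of $\mathrm{Sp}(W)$ by $R^\times$, with the subspace topology from $\mathrm{Sp}(W)\times\mathrm{GL}_R(S)$ ($R$ and $S$ discrete, $\mathrm{GL}_R(S)$ with the compact-open topology). Up to isomorphism of topological central extensions it does not depend on $S$; this isomorphism class, or any member $\mathrm{Mp}(W)$ of it, is the metaplectic group on $W$ associated to $\psi$. Put $\omega_{\psi,S}(g,M)=M\in\mathrm{GL}_R(S)$. Fixing an isomorphism of central extensions $\varphi_S:\mathrm{Mp}(W)\to\widetilde{\mathrm{Sp}}_{\psi,S}^R(W)$ for one $S$, and for the other models $S'$ composing it with the canonical isomorphism $(g,M)\mapsto(g,\phi M\phi^{-1})$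 ($\phi:S\to S'$ any isomorphism of $H$-representations), the representations $(\omega_{\psi,S}\circ\varphi_S,S)$ of $\mathrm{Mp}(W)$ are all isomorphic; $\omega_{\psi,W}^R$ denotes their isomorphism class. Admissible means that the invariants of every open subgroup are finite-dimensional over $R$. *)

theory Defs
  imports "HOL-Analysis.Analysis" "HOL-Algebra.Group"
begin

section \<open>The base field\<close>

text \<open>
  A non-archimedean local field of residual characteristic \<open>p\<close>, presented by an absolute value:
  complete, discretely valued and non-trivially so, with finite residue field
  \<open>{x. v x \<le> 1} / {x. v x < 1}\<close>, in which \<open>p\<close> vanishes.
\<close>

definition local_field_abs :: "nat \<Rightarrow> ('f::field \<Rightarrow> real) \<Rightarrow> bool" where
  "local_field_abs p v \<longleftrightarrow>
     (\<forall>x. 0 \<le> v x) \<and> (\<forall>x. v x = 0 \<longleftrightarrow> x = 0) \<and>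
     (\<forall>x y. v (x * y) = v x * v y) \<and> (\<forall>x y. v (x + y) \<le> max (v x) (v y)) \<and>
     (\<exists>u. 0 < v u \<and> v u < 1 \<and> (\<forall>x. x \<noteq> 0 \<longrightarrow> (\<exists>n::int. v x = v u powi n))) \<and>
     Metric_space.mcomplete UNIV (\<lambda>x y. v (x - y)) \<and>
     finite ({x. v x \<le> 1} // {(x, y). v x \<le> 1 \<and> v y \<le> 1 \<and> v (x - y) < 1}) \<and>
     prime p \<and> v (of_nat p) < 1"

text \<open>\<open>T\<close> is the topology of the field; a finite field is discrete.\<close>

definition finite_or_local_field :: "nat \<Rightarrow> 'f::field topology \<Rightarrow> bool" where
  "finite_or_local_field p T \<longleftrightarrow>
     (finite (UNIV :: 'f set) \<and> CHAR('f) = p \<and> T = discrete_topology UNIV) \<or>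
     (\<exists>v. local_field_abs p v \<and> T = Metric_space.mtopology UNIV (\<lambda>x y. v (x - y)))"

definition additive_group :: "'f::field monoid" where
  "additive_group = \<lparr>carrier = UNIV, mult = (+), one = 0\<rparr>"

definition multiplicative_group :: "'r::field monoid" where
  "multiplicative_group = \<lparr>carrier = {x. x \<noteq> 0}, mult = (*), one = 1\<rparr>"

definition smooth_character :: "'f::field topology \<Rightarrow> ('f \<Rightarrow> 'r::field) \<Rightarrow> bool" where
  "smooth_character T \<psi> \<longleftrightarrow>
     \<psi> \<in> hom additive_group multiplicative_group \<and> openin T {t. \<psi> t = 1}"

section \<open>Representations\<close>

definition GL :: "('r::field \<Rightarrow> 's::ab_group_add \<Rightarrow> 's) \<Rightarrow> ('s \<Rightarrow> 's) monoid" where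
  "GL sc = \<lparr>carrier = {M. Vector_Spaces.linear sc sc M \<and> bij M}, mult = (\<circ>), one = id\<rparr>"

definition topological_group :: "('g, 'z) monoid_scheme \<Rightarrow> 'g topology \<Rightarrow> bool" where
  "topological_group G T \<longleftrightarrow>
     group G \<and> topspace T = carrier G \<and>
     continuous_map (prod_topology T T) T (\<lambda>(x, y). x \<otimes>\<^bsub>G\<^esub> y) \<and>
     continuous_map T T (\<lambda>x. inv\<^bsub>G\<^esub> x)"

definition representation ::
    "('g, 'z) monoid_scheme \<Rightarrow> ('r::field \<Rightarrow> 's::ab_group_add \<Rightarrow> 's) \<Rightarrow> ('g \<Rightarrow> 's \<Rightarrow> 's) \<Rightarrow> bool" where
  "representation G sc \<rho> \<longleftrightarrow> vector_space sc \<and> \<rho> \<in> hom G (GL sc)"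

definition representation_iso ::
    "('g, 'z) monoid_scheme \<Rightarrow> ('r::field \<Rightarrow> 's::ab_group_add \<Rightarrow> 's) \<Rightarrow> ('g \<Rightarrow> 's \<Rightarrow> 's)
      \<Rightarrow> ('r \<Rightarrow> 'v::ab_group_add \<Rightarrow> 'v) \<Rightarrow> ('g \<Rightarrow> 'v \<Rightarrow> 'v) \<Rightarrow> ('s \<Rightarrow> 'v) \<Rightarrow> bool" where
  "representation_iso G sc \<rho> sc' \<rho>' f \<longleftrightarrow>
     Vector_Spaces.linear sc sc' f \<and> bij f \<and>
     (\<forall>g\<in>carrier G. \<forall>s. f (\<rho> g s) = \<rho>' g (f s))"

definition smooth_rep ::
    "('g, 'z) monoid_scheme \<Rightarrow> 'g topology \<Rightarrow> ('g \<Rightarrow> 's \<Rightarrow> 's) \<Rightarrow> bool" where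
  "smooth_rep G T \<rho> \<longleftrightarrow> (\<forall>s. openin T {g \<in> carrier G. \<rho> g s = s})"

definition irreducible_rep ::
    "('g, 'z) monoid_scheme \<Rightarrow> ('r::field \<Rightarrow> 's::ab_group_add \<Rightarrow> 's) \<Rightarrow> ('g \<Rightarrow> 's \<Rightarrow> 's) \<Rightarrow> bool" where
  "irreducible_rep G sc \<rho> \<longleftrightarrow>
     (\<exists>s::'s. s \<noteq> 0) \<and>
     (\<forall>U. module.subspace sc U \<and> (\<forall>g\<in>carrier G. \<rho> g ` U \<subseteq> U) \<longrightarrow> U = {0} \<or> U = UNIV)"

definition invariants :: "'g set \<Rightarrow> ('g \<Rightarrow> 's \<Rightarrow> 's) \<Rightarrow> 's set" where
  "invariants K \<rho> = {s. \<forall>k\<in>K. \<rho> k s = s}"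

definition admissible_rep ::
    "('g, 'z) monoid_scheme \<Rightarrow> 'g topology \<Rightarrow> ('r::field \<Rightarrow> 's::ab_group_add \<Rightarrow> 's)
      \<Rightarrow> ('g \<Rightarrow> 's \<Rightarrow> 's) \<Rightarrow> bool" where
  "admissible_rep G T sc \<rho> \<longleftrightarrow>
     (\<forall>K. subgroup K G \<and> openin T K \<longrightarrow>
        (\<exists>X. finite X \<and> module.span sc X = invariants K \<rho>))"

section \<open>Symplectic spaces and the Heisenberg group\<close>

definition symplectic_form ::
    "('f::field \<Rightarrow> 'w::ab_group_add \<Rightarrow> 'w) \<Rightarrow> ('w \<Rightarrow> 'w \<Rightarrow> 'f) \<Rightarrow> bool" where
  "symplectic_form sc B \<longleftrightarrow>
     (\<forall>w. Vector_Spaces.linear sc (*) (\<lambda>w'. B w w')) \<and>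
     (\<forall>w'. Vector_Spaces.linear sc (*) (\<lambda>w. B w w')) \<and>
     (\<forall>w. B w w = 0) \<and>
     (\<forall>w. (\<forall>w'. B w w' = 0) \<longrightarrow> w = 0)"

text \<open>
  The topology of \<open>W\<close> is that of its coordinate space \<open>F\<^sup>n\<close>, and the topology of \<open>Sp(W)\<close> that of its
  matrix entries. The basis \<open>Bs\<close> only serves to name coordinates: the topologies do not depend
  on it.
\<close>

definition space_topology ::
    "'f::field topology \<Rightarrow> ('f \<Rightarrow> 'w::ab_group_add \<Rightarrow> 'w) \<Rightarrow> 'w set \<Rightarrow> 'w topology" where
  "space_topology T sc Bs =
     pullback_topology UNIV (\<lambda>w. \<lambda>b\<in>Bs. module.representation sc Bs w b)
       (product_topology (\<lambda>_. T) Bs)"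

definition heisenberg_group :: "('w::ab_group_add \<Rightarrow> 'w \<Rightarrow> 'f::field) \<Rightarrow> ('w \<times> 'f) monoid" where
  "heisenberg_group B =
     \<lparr>carrier = UNIV,
      mult = (\<lambda>(w, t) (w', t'). (w + w', t + t' + B w w' / 2)),
      one = (0, 0)\<rparr>"

definition heisenberg_topology ::
    "'f::field topology \<Rightarrow> ('f \<Rightarrow> 'w::ab_group_add \<Rightarrow> 'w) \<Rightarrow> 'w set \<Rightarrow> ('w \<times> 'f) topology" where
  "heisenberg_topology T sc Bs = prod_topology (space_topology T sc Bs) T"

text \<open>\<open>(\<rho>, S)\<close> is an irreducible smooth representation of \<open>H\<close> with central character \<open>\<psi>\<close>.\<close>

definition heisenberg_model ::
    "'f::field topology \<Rightarrow> ('f \<Rightarrow> 'w::ab_group_add \<Rightarrow> 'w) \<Rightarrow> 'w set \<Rightarrow> ('w \<Rightarrow> 'w \<Rightarrow> 'f)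
      \<Rightarrow> ('f \<Rightarrow> 'r::field) \<Rightarrow> ('r \<Rightarrow> 's::ab_group_add \<Rightarrow> 's) \<Rightarrow> ('w \<times> 'f \<Rightarrow> 's \<Rightarrow> 's) \<Rightarrow> bool" where
  "heisenberg_model T scW Bs B \<psi> scS \<rho> \<longleftrightarrow>
     representation (heisenberg_group B) scS \<rho> \<and>
     irreducible_rep (heisenberg_group B) scS \<rho> \<and>
     smooth_rep (heisenberg_group B) (heisenberg_topology T scW Bs) \<rho> \<and>
     (\<forall>t s. \<rho> (0, t) s = scS (\<psi> t) s)"

text \<open>
  \<open>Sp(W)\<close> consists of the linear automorphisms \<open>g\<close> of \<open>W\<close> preserving the form, multiplied as
  operators acting on the right: the product of \<open>g\<close> and \<open>h\<close> is ``first \<open>g\<close>, then \<open>h\<close>''. With the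
  defining relation \<open>M \<rho>(w,t) M\<^sup>-\<^sup>1 = \<rho>(g\<^sup>-\<^sup>1 w, t)\<close> of the metaplectic group this is forced: if
  \<open>(g, M)\<close> and \<open>(h, N)\<close> satisfy it, then
  \<open>(M N) \<rho>(w,t) (M N)\<^sup>-\<^sup>1 = M \<rho>(h\<^sup>-\<^sup>1 w, t) M\<^sup>-\<^sup>1 = \<rho>(g\<^sup>-\<^sup>1 (h\<^sup>-\<^sup>1 w), t)\<close>,
  so that \<open>M N\<close> lies over \<open>h \<circ> g\<close>, and in general not over \<open>g \<circ> h\<close>. The map \<open>g \<mapsto> g\<^sup>-\<^sup>1\<close> identifies
  this group with the one whose product is \<open>g \<circ> h\<close>.
\<close>

definition Sp :: "('f::field \<Rightarrow> 'w::ab_group_add \<Rightarrow> 'w) \<Rightarrow> ('w \<Rightarrow> 'w \<Rightarrow> 'f) \<Rightarrow> ('w \<Rightarrow> 'w) monoid" where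
  "Sp sc B =
     \<lparr>carrier = {g \<in> carrier (GL sc). \<forall>w w'. B (g w) (g w') = B w w'},
      mult = (\<lambda>g h. h \<circ> g),
      one = id\<rparr>"

definition Sp_topology ::
    "'f::field topology \<Rightarrow> ('f \<Rightarrow> 'w::ab_group_add \<Rightarrow> 'w) \<Rightarrow> 'w set \<Rightarrow> ('w \<Rightarrow> 'w \<Rightarrow> 'f)
      \<Rightarrow> ('w \<Rightarrow> 'w) topology" where
  "Sp_topology T sc Bs B =
     pullback_topology (carrier (Sp sc B))
       (\<lambda>g. \<lambda>(b, b')\<in>Bs \<times> Bs. module.representation sc Bs (g b') b)
       (product_topology (\<lambda>_. T) (Bs \<times> Bs))"

section \<open>The metaplectic group\<close>

text \<open>The compact-open topology on a set \<open>X\<close> of maps.\<close>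

definition compact_open_topology ::
    "'a topology \<Rightarrow> 'b topology \<Rightarrow> ('a \<Rightarrow> 'b) set \<Rightarrow> ('a \<Rightarrow> 'b) topology" where
  "compact_open_topology TA TB X =
     topology_generated_by {{f \<in> X. f ` K \<subseteq> U} |K U. compactin TA K \<and> openin TB U}"

definition GL_topology ::
    "('r::field \<Rightarrow> 's::ab_group_add \<Rightarrow> 's) \<Rightarrow> ('s \<Rightarrow> 's) topology" where
  "GL_topology sc =
     compact_open_topology (discrete_topology UNIV) (discrete_topology UNIV) (carrier (GL sc))"

text \<open>
  The data of a topological central extension \<open>A \<rightarrow> E \<rightarrow> G\<close>: the group \<open>E\<close> with its topology, the
  inclusion of \<open>A\<close> and the projection to \<open>G\<close>. Exactness and centrality are not part of the record;
  they are inherited along isomorphisms.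
\<close>

record ('a, 'e, 'g) extension = "'e monoid" +
  ext_topology :: "'e topology"
  ext_incl :: "'a \<Rightarrow> 'e"
  ext_proj :: "'e \<Rightarrow> 'g"

definition extension_iso ::
    "'a monoid \<Rightarrow> ('a, 'e, 'g) extension \<Rightarrow> ('a, 'd, 'g) extension \<Rightarrow> ('e \<Rightarrow> 'd) \<Rightarrow> bool" where
  "extension_iso A E D \<phi> \<longleftrightarrow>
     \<phi> \<in> iso E D \<and> homeomorphic_map (ext_topology E) (ext_topology D) \<phi> \<and>
     (\<forall>a\<in>carrier A. \<phi> (ext_incl E a) = ext_incl D a) \<and>
     (\<forall>x\<in>carrier E. ext_proj D (\<phi> x) = ext_proj E x)"

text \<open>The group of pairs \<open>(g, M)\<close> built from the model \<open>(\<rho>, S)\<close>, as an extension of \<open>Sp(W)\<close> by \<open>R\<^sup>\<times>\<close>.\<close>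

definition Sp_tilde_carrier ::
    "('f::field \<Rightarrow> 'w::ab_group_add \<Rightarrow> 'w) \<Rightarrow> ('w \<Rightarrow> 'w \<Rightarrow> 'f)
      \<Rightarrow> ('r::field \<Rightarrow> 's::ab_group_add \<Rightarrow> 's) \<Rightarrow> ('w \<times> 'f \<Rightarrow> 's \<Rightarrow> 's)
      \<Rightarrow> (('w \<Rightarrow> 'w) \<times> ('s \<Rightarrow> 's)) set" where
  "Sp_tilde_carrier scW B scS \<rho> =
     {(g, M) \<in> carrier (Sp scW B) \<times> carrier (GL scS).
        \<forall>w t. M \<circ> \<rho> (w, t) \<circ> inv_into UNIV M = \<rho> (inv_into UNIV g w, t)}"

definition Sp_tilde ::
    "'f::field topology \<Rightarrow> ('f \<Rightarrow> 'w::ab_group_add \<Rightarrow> 'w) \<Rightarrow> 'w set \<Rightarrow> ('w \<Rightarrow> 'w \<Rightarrow> 'f)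
      \<Rightarrow> ('r::field \<Rightarrow> 's::ab_group_add \<Rightarrow> 's) \<Rightarrow> ('w \<times> 'f \<Rightarrow> 's \<Rightarrow> 's)
      \<Rightarrow> ('r, ('w \<Rightarrow> 'w) \<times> ('s \<Rightarrow> 's), 'w \<Rightarrow> 'w) extension" where
  "Sp_tilde T scW Bs B scS \<rho> =
     \<lparr>carrier = Sp_tilde_carrier scW B scS \<rho>,
      mult = (\<lambda>(g, M) (h, N). (g \<otimes>\<^bsub>Sp scW B\<^esub> h, M \<otimes>\<^bsub>GL scS\<^esub> N)),
      one = (\<one>\<^bsub>Sp scW B\<^esub>, \<one>\<^bsub>GL scS\<^esub>),
      ext_topology = subtopology (prod_topology (Sp_topology T scW Bs B) (GL_topology scS))
                       (Sp_tilde_carrier scW B scS \<rho>),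
      ext_incl = (\<lambda>a. (id, scS a)),
      ext_proj = fst\<rparr>"

text \<open>
  \<open>\<phi>\<close> exhibits \<open>Mp\<close> as a metaplectic group on \<open>W\<close>, that is, as a member of the isomorphism class of
  the topological central extension built from the model.
\<close>

definition metaplectic_group ::
    "'f::field topology \<Rightarrow> ('f \<Rightarrow> 'w::ab_group_add \<Rightarrow> 'w) \<Rightarrow> 'w set \<Rightarrow> ('w \<Rightarrow> 'w \<Rightarrow> 'f)
      \<Rightarrow> ('r::field \<Rightarrow> 's::ab_group_add \<Rightarrow> 's) \<Rightarrow> ('w \<times> 'f \<Rightarrow> 's \<Rightarrow> 's)
      \<Rightarrow> ('r, 'm, 'w \<Rightarrow> 'w) extension \<Rightarrow> ('m \<Rightarrow> ('w \<Rightarrow> 'w) \<times> ('s \<Rightarrow> 's)) \<Rightarrow> bool" where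
  "metaplectic_group T scW Bs B scS \<rho> Mp \<phi> \<longleftrightarrow>
     topological_group Mp (ext_topology Mp) \<and>
     extension_iso multiplicative_group Mp (Sp_tilde T scW Bs B scS \<rho>) \<phi>"

definition omega :: "('w \<Rightarrow> 'w) \<times> ('s \<Rightarrow> 's) \<Rightarrow> 's \<Rightarrow> 's" where
  "omega = snd"

text \<open>\<open>(\<pi>, V)\<close> is a member of the isomorphism class of \<open>(\<omega> \<circ> \<phi>, S)\<close>.\<close>

definition weil_representation ::
    "('r::field, 'm, 'w \<Rightarrow> 'w) extension \<Rightarrow> ('m \<Rightarrow> ('w \<Rightarrow> 'w) \<times> ('s \<Rightarrow> 's))
      \<Rightarrow> ('r \<Rightarrow> 's::ab_group_add \<Rightarrow> 's) \<Rightarrow> ('r \<Rightarrow> 'v::ab_group_add \<Rightarrow> 'v)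
      \<Rightarrow> ('m \<Rightarrow> 'v \<Rightarrow> 'v) \<Rightarrow> bool" where
  "weil_representation Mp \<phi> scS scV \<pi> \<longleftrightarrow>
     representation Mp scV \<pi> \<and> (\<exists>f. representation_iso Mp scS (omega \<circ> \<phi>) scV \<pi> f)"

end

theory Submission
  imports Defs
begin

text \<open>
  Smoothness is immediate, because \<open>GL(S)\<close> carries the topology of pointwise convergence. For
  admissibility, fix a basis vector \<open>u\<close> of \<open>W\<close>. By irreducibility \<open>S\<close> is spanned by vectors
  \<open>\<rho>(w,0) s\<^sub>0\<close>, and these are eigenvectors of the operators \<open>\<rho>(x u,0)\<close> for small \<open>x\<close>, with
  eigencharacter \<open>x \<mapsto> \<psi>(x a)\<close>, \<open>a = \<langle>u,w\<rangle>\<close>. Acting on the eigenspace of \<open>a\<close> by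
  \<open>\<psi>(-c a\<^sup>2/2) \<rho>(c a u,0)\<close> gives, for small \<open>c\<close>, an explicit lift to the metaplectic group of the
  transvection \<open>w \<mapsto> w - c \<langle>u,w\<rangle> u\<close>, trivial on the eigenspace of \<open>0\<close>. So an open subgroup
  contains these lifts for all sufficiently small \<open>c\<close>, and oscillation of the quadratic phase
  confines its invariants to eigenspaces with bounded \<open>a\<close>: they are fixed by \<open>\<rho>(x u,0)\<close> for all
  \<open>x\<close> in a fixed ball. Letting \<open>u\<close> run through the basis, the invariants are fixed by a lattice
  \<open>L\<close> of \<open>W\<close>. If \<open>s\<^sub>0\<close> is such a vector, then comparing eigencharacters of \<open>L\<close> shows that all of
  them lie in the span of the \<open>\<rho>(w,0) s\<^sub>0\<close> with \<open>w\<close> in the annihilator of \<open>L\<close>, which is a finite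
  union of cosets of \<open>L\<close>.
\<close>

section \<open>The base field\<close>

locale nonarch_abs =
  fixes v :: "'f::field \<Rightarrow> real"
  assumes nonneg: "0 \<le> v x"
    and zero_iff [simp]: "v x = 0 \<longleftrightarrow> x = 0"
    and mult: "v (x * y) = v x * v y"
    and ultra: "v (x + y) \<le> max (v x) (v y)"
begin

lemma zero [simp]: "v 0 = 0"
  by simp

lemma one [simp]: "v 1 = 1"
  using mult[of 1 1] by simp

lemma minus [simp]: "v (- x) = v x"
proof -
  have "v (- 1) * v (- 1) = 1"
    using mult[of "- 1" "- 1"] by simp
  then have "v (- 1) = 1"
    using nonneg[of "- 1"] by (metis abs_of_nonneg abs_square_eq_1 power2_eq_square)
  then show ?thesis
    using mult[of "- 1" x] by simp
qed

lemma pos: "x \<noteq> 0 \<Longrightarrow> 0 < v x"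
  using nonneg[of x] zero_iff[of x] by linarith

lemma inverse: "v (inverse x) = inverse (v x)"
proof (cases "x = 0")
  case False
  have "v x * v (inverse x) = 1"
    using mult[of x "inverse x"] False by simp
  then show ?thesis
    by (simp add: inverse_unique)
qed simp

lemma divide: "v (x / y) = v x / v y"
  by (simp add: divide_inverse mult inverse)

lemma power: "v (x ^ n) = v x ^ n"
  by (induction n) (simp_all add: mult)

lemma sum_le:
  assumes "\<And>i. i \<in> A \<Longrightarrow> v (f i) \<le> r" and "0 \<le> r"
  shows "v (sum f A) \<le> r"
  using assms
proof (induction A rule: infinite_finite_induct)
  case (insert x F)
  then show ?case
    using ultra[of "f x" "sum f F"] by (fastforce intro: order_trans)
qed simp_all

lemma Metric_space: "Metric_space UNIV (\<lambda>x y. v (x - y))"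
proof
  fix x y z :: 'f
  show "v (x - y) = v (y - x)"
    using minus[of "x - y"] by simp
  show "v (x - z) \<le> v (x - y) + v (y - z)"
    using ultra[of "x - y" "y - z"] nonneg[of "x - y"] nonneg[of "y - z"] by simp
qed (simp_all add: nonneg)

lemma openin_mtopology_iff:
  "openin (Metric_space.mtopology UNIV (\<lambda>x y. v (x - y))) U \<longleftrightarrow>
     (\<forall>x\<in>U. \<exists>r>0. \<forall>y. v (y - x) \<le> r \<longrightarrow> y \<in> U)"
proof -
  have "v (x - y) = v (y - x)" for x y
    using minus[of "x - y"] by simp
  then show ?thesis
    unfolding Metric_space.openin_mtopology_mcball[OF Metric_space]
      Metric_space.mcball_def[OF Metric_space] by (simp add: subset_iff Ball_def)
qed

end

lemma (in nonarch_abs) continuous_map_affine: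
  fixes c d :: 'f
  defines "T \<equiv> Metric_space.mtopology UNIV (\<lambda>x y. v (x - y))"
  shows "continuous_map T T (\<lambda>x. c + x * d)"
  unfolding continuous_map_def
proof (intro conjI allI impI)
  have top: "topspace T = UNIV"
    unfolding T_def by (rule Metric_space.topspace_mtopology[OF Metric_space])
  then show "(\<lambda>x. c + x * d) \<in> topspace T \<rightarrow> topspace T"
    by simp
  fix U
  assume U: "openin T U"
  show "openin T {x \<in> topspace T. c + x * d \<in> U}"
    unfolding T_def openin_mtopology_iff
  proof
    fix x
    assume "x \<in> {x \<in> topspace (Metric_space.mtopology UNIV (\<lambda>x y. v (x - y))). c + x * d \<in> U}"
    then obtain r where r: "0 < r" "\<And>y. v (y - (c + x * d)) \<le> r \<Longrightarrow> y \<in> U"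
      using U unfolding T_def openin_mtopology_iff by blast
    \<comment> \<open>The \<open>1 +\<close> in the denominator keeps the radius meaningful when
      \<open>d = 0\<close>.\<close>
    have "c + y * d \<in> U" if "v (y - x) \<le> r / (1 + v d)" for y
    proof -
      have "v (y - x) * v d \<le> r / (1 + v d) * (1 + v d)"
        using that nonneg r by (intro mult_mono) auto
      then have "v ((y - x) * d) \<le> r"
        using nonneg[of d] by (simp add: mult)
      then show ?thesis
        by (intro r) (simp add: algebra_simps)
    qed
    then show "\<exists>r>0. \<forall>y. v (y - x) \<le> r \<longrightarrow>
        y \<in> {x \<in> topspace (Metric_space.mtopology UNIV (\<lambda>x y. v (x - y))). c + x * d \<in> U}"
      using r(1) nonneg[of d] top unfolding T_def
      by (intro exI[of _ "r / (1 + v d)"]) simp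
  qed
qed

lemma (in nonarch_abs) ball_in_preimage:
  assumes "continuous_map (Metric_space.mtopology UNIV (\<lambda>x y. v (x - y))) X f"
    and "openin X U" "f 0 \<in> U"
  shows "\<exists>r>0. \<forall>x. v x \<le> r \<longrightarrow> f x \<in> U"
proof -
  have "openin (Metric_space.mtopology UNIV (\<lambda>x y. v (x - y))) {x. f x \<in> U}"
    using openin_continuous_map_preimage[OF assms(1,2)]
    by (simp add: Metric_space.topspace_mtopology[OF Metric_space])
  then show ?thesis
    using assms(3) unfolding openin_mtopology_iff by force
qed

section \<open>Total boundedness of balls in the field\<close>

lemma local_field_abs_imp_nonarch_abs: "local_field_abs p v \<Longrightarrow> nonarch_abs v"
  by (simp add: local_field_abs_def nonarch_abs_def)

text \<open>The centres are truncated expansions in powers of an element \<open>u\<close> whose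
  value generates the value group, with one digit per residue class; a rescaling then reaches
  arbitrary radii.\<close>

lemma local_field_ball_covering:
  assumes lf: "local_field_abs p v" and "0 < r"
  shows "\<exists>X. finite X \<and> (\<forall>x. v x \<le> R \<longrightarrow> (\<exists>y\<in>X. v (x - y) \<le> r))"
proof -
  interpret nonarch_abs v
    using lf by (rule local_field_abs_imp_nonarch_abs)
  have "\<exists>u. 0 < v u \<and> v u < 1 \<and> (\<forall>x. x \<noteq> 0 \<longrightarrow> (\<exists>n::int. v x = v u powi n))"
    using lf unfolding local_field_abs_def by (elim conjE) assumption
  then obtain u where u: "0 < v u" "v u < 1"
    and gen: "\<And>x. x \<noteq> 0 \<Longrightarrow> \<exists>n::int. v x = v u powi n"
    by blast
  have u0: "u \<noteq> 0"
    using u(1) zero_iff by force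
  define E where "E = {(x, y). v x \<le> 1 \<and> v y \<le> 1 \<and> v (x - y) < 1}"
  have fin: "finite ({x. v x \<le> 1} // E)"
    using lf unfolding local_field_abs_def E_def by (elim conjE) assumption
  \<comment> \<open>Values of nonzero elements are integral powers of \<open>v u\<close>, so nothing
    lies strictly between \<open>v u\<close> and 1, and congruence modulo the open unit ball is
    approximation to precision \<open>v u\<close>.\<close>
  have lt_one: "v x \<le> v u" if "v x < 1" for x
  proof (cases "x = 0")
    case False
    then obtain n where n: "v x = v u powi n"
      using gen by blast
    have "0 < n"
    proof (rule ccontr)
      assume "\<not> 0 < n"
      then have "1 \<le> v u powi n"
        using u u0 power_int_decreasing[of n 0 "v u"] by simp
      then show False
        using n that by simp
    qed
    then show ?thesis
      using u u0 n power_int_decreasing[of 1 n "v u"] by simp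
  qed (use u in simp)
  define X0 where "X0 = (\<lambda>C. SOME x. x \<in> C) ` ({x. v x \<le> 1} // E)"
  have "finite X0"
    unfolding X0_def using fin by simp
  have X0: "\<exists>y\<in>X0. v (x - y) \<le> v u" if "v x \<le> 1" for x
  proof -
    have "x \<in> E `` {x}"
      using that by (simp add: E_def)
    then have "(SOME y. y \<in> E `` {x}) \<in> E `` {x}"
      by (rule someI)
    moreover have "v (x - y) < 1" if "y \<in> E `` {x}" for y
      using that by (simp add: E_def)
    ultimately have "v (x - (SOME y. y \<in> E `` {x})) < 1"
      by blast
    moreover have "E `` {x} \<in> {x. v x \<le> 1} // E"
      using that by (auto simp: quotient_def)
    ultimately show ?thesis
      unfolding X0_def using lt_one by blast
  qed
  have iter: "\<exists>X. finite X \<and> (\<forall>x. v x \<le> 1 \<longrightarrow> (\<exists>y\<in>X. v (x - y) \<le> v u ^ n))" for n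
  proof (induction n)
    case 0
    show ?case
      by (rule exI[of _ "{0}"]) simp
  next
    case (Suc n)
    then obtain X where X: "finite X" "\<And>x. v x \<le> 1 \<Longrightarrow> \<exists>y\<in>X. v (x - y) \<le> v u ^ n"
      by blast
    \<comment> \<open>The next digit \<open>z\<close> represents the residue class of
      \<open>(x - y) / u ^ n\<close>.\<close>
    have "\<exists>y\<in>(\<lambda>(y, z). y + u ^ n * z) ` (X \<times> X0). v (x - y) \<le> v u ^ Suc n" if x: "v x \<le> 1" for x
    proof -
      obtain y where y: "y \<in> X" "v (x - y) \<le> v u ^ n"
        using X(2) x by blast
      have "v ((x - y) / u ^ n) \<le> 1"
        using y u by (simp add: divide power)
      then obtain z where z: "z \<in> X0" "v ((x - y) / u ^ n - z) \<le> v u"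
        using X0 by blast
      have "x - (y + u ^ n * z) = u ^ n * ((x - y) / u ^ n - z)"
        using u0 by (simp add: field_simps)
      then have "v (x - (y + u ^ n * z)) = v u ^ n * v ((x - y) / u ^ n - z)"
        by (simp only: mult power)
      also have "\<dots> \<le> v u ^ n * v u"
        using z u by (intro mult_left_mono) simp_all
      finally have "v (x - (y + u ^ n * z)) \<le> v u ^ Suc n"
        by (simp add: mult.commute)
      moreover have "y + u ^ n * z \<in> (\<lambda>(y, z). y + u ^ n * z) ` (X \<times> X0)"
        using y z by force
      ultimately show ?thesis
        by blast
    qed
    then show ?case
      using X(1) \<open>finite X0\<close>
      by (intro exI[of _ "(\<lambda>(y, z). y + u ^ n * z) ` (X \<times> X0)"] conjI) simp_all
  qed
  \<comment> \<open>Multiplication by \<open>t = u ^ m\<close> carries the ball of radius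
    \<open>R\<close> into the unit ball; dividing by \<open>t\<close> afterwards inflates the error,
    which the choice of \<open>n\<close> compensates.\<close>
  obtain m where m: "(1 / v u) ^ m > R"
    using real_arch_pow[of "1 / v u" R] u by auto
  define t where "t = u ^ m"
  have t: "v t = v u ^ m" "t \<noteq> 0"
    using u0 by (simp_all add: power t_def)
  obtain n where n: "v u ^ n < r * v t"
    using real_arch_pow_inv[of "r * v t" "v u"] u \<open>0 < r\<close> t by auto
  obtain X where X: "finite X" "\<And>x. v x \<le> 1 \<Longrightarrow> \<exists>y\<in>X. v (x - y) \<le> v u ^ n"
    using iter by blast
  have "\<exists>y\<in>(\<lambda>y. y / t) ` X. v (x - y) \<le> r" if x: "v x \<le> R" for x
  proof -
    have "v x \<le> (1 / v u) ^ m"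
      using x m by simp
    then have "v (x * t) \<le> 1"
      using u by (simp add: mult t power_one_over field_simps)
    then obtain y where y: "y \<in> X" "v (x * t - y) \<le> v u ^ n"
      using X(2) by blast
    have "x - y / t = (x * t - y) / t"
      using t by (simp add: field_simps)
    then have "v (x - y / t) \<le> r"
      using y n t pos[of t] by (simp add: divide field_simps)
    then show ?thesis
      using y by blast
  qed
  then show ?thesis
    using X(1) by (intro exI[of _ "(\<lambda>y. y / t) ` X"] conjI) simp_all
qed

text \<open>A finite field carries the trivial absolute value, so both kinds of base field can be treated
  alike.\<close>

lemma finite_or_local_field_abs:
  assumes "finite_or_local_field p T"
  shows "\<exists>v. nonarch_abs v \<and> T = Metric_space.mtopology UNIV (\<lambda>x y. v (x - y)) \<and>
    (\<forall>r>0. \<forall>R. \<exists>X. finite X \<and> (\<forall>x. v x \<le> R \<longrightarrow> (\<exists>y\<in>X. v (x - y) \<le> r)))"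
  using assms unfolding finite_or_local_field_def
proof (elim disjE exE conjE)
  assume fin: "finite (UNIV :: 'a set)" and T: "T = discrete_topology UNIV"
  define v :: "'a \<Rightarrow> real" where "v x = (if x = 0 then 0 else 1)" for x
  interpret nonarch_abs v
    by unfold_locales (auto simp: v_def)
  have "openin T U \<longleftrightarrow> openin (Metric_space.mtopology UNIV (\<lambda>x y. v (x - y))) U" for U
    unfolding openin_mtopology_iff T
    by (auto simp: v_def split: if_splits intro!: exI[of _ "1/2"])
  then have "T = Metric_space.mtopology UNIV (\<lambda>x y. v (x - y))"
    by (simp add: topology_eq)
  moreover have "\<forall>r>0. \<forall>R. \<exists>X. finite X \<and> (\<forall>x. v x \<le> R \<longrightarrow> (\<exists>y\<in>X. v (x - y) \<le> r))"
  proof (intro allI impI)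
    fix r R :: real
    assume "0 < r"
    then have "\<exists>y\<in>UNIV. v (x - y) \<le> r" for x
      by (intro bexI[of _ x]) simp_all
    then show "\<exists>X. finite X \<and> (\<forall>x. v x \<le> R \<longrightarrow> (\<exists>y\<in>X. v (x - y) \<le> r))"
      using fin by blast
  qed
  ultimately show ?thesis
    using nonarch_abs_axioms by blast
next
  fix v
  assume lf: "local_field_abs p v" and T: "T = Metric_space.mtopology UNIV (\<lambda>x y. v (x - y))"
  show ?thesis
    using local_field_abs_imp_nonarch_abs[OF lf] T local_field_ball_covering[OF lf]
    by (intro exI[of _ v]) simp
qed


section \<open>Operators of the Heisenberg group\<close>

text \<open>A vector \<open>x\<close> of \<open>C\<close> with a wrong eigenvalue \<open>l\<close>
  of some \<open>T i\<close> can be discarded: \<open>m i - T i\<close> kills \<open>s\<close>,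
  preserves the span of the other vectors and multiplies \<open>x\<close> by the nonzero scalar
  \<open>m i - l\<close>.\<close>

lemma (in vector_space) joint_eigenvector_in_span:
  assumes lin: "\<And>i. i \<in> I \<Longrightarrow> Vector_Spaces.linear scale scale (T i)"
    and eig: "\<And>i x. i \<in> I \<Longrightarrow> x \<in> C \<Longrightarrow> \<exists>l. T i x = scale l x"
    and s: "\<And>i. i \<in> I \<Longrightarrow> T i s = scale (m i) s" and "s \<in> span C"
  shows "s \<in> span {x \<in> C. \<forall>i\<in>I. T i x = scale (m i) x}"
proof -
  define G where "G = {x \<in> C. \<forall>i\<in>I. T i x = scale (m i) x}"
  have remove: "s \<in> span G" if "finite F" "F \<subseteq> C" "s \<in> span (G \<union> F)" for F
    using that
  proof (induction F)
    case (insert x F)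
    let ?V = "span (G \<union> F)"
    have "s \<in> ?V"
    proof (cases "x \<in> G")
      case True
      then show ?thesis
        using insert.prems by (simp add: insert_absorb)
    next
      case False
      then obtain i where i: "i \<in> I" "T i x \<noteq> scale (m i) x"
        using insert.prems unfolding G_def by auto
      interpret Ti: Vector_Spaces.linear scale scale "T i"
        using lin i by simp
      obtain l where l: "T i x = scale l x"
        using eig i insert.prems by blast
      have stable: "T i y \<in> ?V" if "y \<in> ?V" for y
        using that
      proof (induction rule: span_induct_alt)
        case (step c y z)
        then have "y \<in> C"
          using insert.prems unfolding G_def by auto
        then obtain l' where "T i y = scale l' y"
          using eig i by blast
        then show ?case
          using step span_base[of y "G \<union> F"]
          by (simp add: Ti.add Ti.scale span_add span_scale)
      qed (simp add: Ti.zero span_zero)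
      obtain k where k: "s - scale k x \<in> ?V"
        using insert.prems by (auto simp: span_insert)
      \<comment> \<open>Here \<open>s\<close> cancels, which isolates a multiple of \<open>x\<close>
        inside the span of the other vectors.\<close>
      have "scale (m i) (s - scale k x) - T i (s - scale k x) = scale (k * (l - m i)) x"
        using s i l by (simp add: Ti.diff Ti.scale algebra_simps)
      then have "scale (k * (l - m i)) x \<in> ?V"
        using k stable span_diff span_scale by metis
      moreover have "l - m i \<noteq> 0"
        using i l by auto
      ultimately have "scale k x \<in> ?V"
        using span_scale[of "scale (k * (l - m i)) x" "G \<union> F" "inverse (l - m i)"]
        by (simp add: mult.left_commute)
      then show ?thesis
        using k span_add[of "s - scale k x" "G \<union> F" "scale k x"] by simp
    qed
    then show ?case
      using insert by simp
  qed simp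
  obtain F where "finite F" "F \<subseteq> C" "s \<in> span F"
    using \<open>s \<in> span C\<close> unfolding span_explicit by blast
  then show ?thesis
    using remove[of F] span_mono[of F "G \<union> F"] unfolding G_def by blast
qed

lemma (in vector_space) finite_spanning_subset:
  assumes "subspace U" "finite Y" "U \<subseteq> span Y"
  shows "\<exists>X. finite X \<and> span X = U"
proof -
  obtain X where X: "X \<subseteq> U" "independent X" "U \<subseteq> span X"
    using maximal_independent_subset .
  then have "finite X"
    using independent_span_bound[OF assms(2)] assms(3) by blast
  moreover have "span X = U"
    using X span_minimal[OF X(1) assms(1)] by blast
  ultimately show ?thesis
    by blast
qed

text \<open>Compact subsets of a discrete space are finite, so each subbasic condition involves only
  finitely many vectors.\<close>

lemma GL_topology_pointwise:
  assumes "openin (GL_topology sc) V" "M \<in> V"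
  shows "\<exists>Z. finite Z \<and> (\<forall>f\<in>carrier (GL sc). (\<forall>z\<in>Z. f z = M z) \<longrightarrow> f \<in> V)"
proof -
  have "generate_topology_on {{f \<in> carrier (GL sc). f ` K \<subseteq> U} |K U.
      compactin (discrete_topology UNIV) K \<and> openin (discrete_topology UNIV) U} V"
    using assms(1) unfolding GL_topology_def compact_open_topology_def
    by (rule openin_topology_generated_by)
  then show ?thesis
    using assms(2)
  proof (induction rule: generate_topology_on.induct)
    case (Int a b)
    then obtain Z Z' where "finite Z" "\<forall>f\<in>carrier (GL sc). (\<forall>z\<in>Z. f z = M z) \<longrightarrow> f \<in> a"
      "finite Z'" "\<forall>f\<in>carrier (GL sc). (\<forall>z\<in>Z'. f z = M z) \<longrightarrow> f \<in> b"
      by blast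
    then show ?case
      by (intro exI[of _ "Z \<union> Z'"]) simp
  next
    case (UN K)
    then obtain k where "k \<in> K" "M \<in> k"
      by blast
    with UN.IH[OF this] show ?case
      by blast
  next
    case (Basis s)
    then obtain K U where "finite K" "s = {f \<in> carrier (GL sc). f ` K \<subseteq> U}"
      by (auto simp: compactin_discrete_topology)
    then show ?case
      using Basis.prems by (intro exI[of _ K]) auto
  qed simp
qed

text \<open>The model restricted to \<open>W\<close>: \<open>P w\<close> stands for
  \<open>\<rho> (w, 0)\<close>, a projective representation with cocycle
  \<open>\<psi> (B w w' / 2)\<close>. Smoothness is recorded along the basis lines, and
  \<open>covering\<close> is the total boundedness shared by finite and local fields.\<close>

locale heisenberg_operators =
  V: nonarch_abs v + W: finite_dimensional_vector_space scW Bs + S: vector_space scS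
  for v :: "'f::field \<Rightarrow> real"
    and scW :: "'f \<Rightarrow> 'w::ab_group_add \<Rightarrow> 'w"
    and Bs :: "'w set"
    and scS :: "'r::field \<Rightarrow> 's::ab_group_add \<Rightarrow> 's" +
  fixes B :: "'w \<Rightarrow> 'w \<Rightarrow> 'f"
    and \<psi> :: "'f \<Rightarrow> 'r"
    and P :: "'w \<Rightarrow> 's \<Rightarrow> 's"
  assumes covering: "\<And>r R. 0 < r \<Longrightarrow> \<exists>X. finite X \<and> (\<forall>x. v x \<le> R \<longrightarrow> (\<exists>y\<in>X. v (x - y) \<le> r))"
    and two: "(2::'f) \<noteq> 0"
    and form: "symplectic_form scW B"
    and psi_add: "\<psi> (x + y) = \<psi> x * \<psi> y"
    and psi_nonzero [simp]: "\<psi> x \<noteq> 0"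
    and psi_ball: "\<exists>d>0. \<forall>x. v x \<le> d \<longrightarrow> \<psi> x = 1"
    and psi_nontrivial: "\<exists>t. \<psi> t \<noteq> 1"
    and P_linear: "Vector_Spaces.linear scS scS (P w)"
    and P_zero [simp]: "P 0 s = s"
    and P_mult: "P w (P w' s) = scS (\<psi> (B w w' / 2)) (P (w + w') s)"
    and irreducible: "\<And>U. S.subspace U \<Longrightarrow> (\<And>w. P w ` U \<subseteq> U) \<Longrightarrow> U = {0} \<or> U = UNIV"
    and smooth: "b \<in> Bs \<Longrightarrow> \<exists>r>0. \<forall>x. v x \<le> r \<longrightarrow> P (scW x b) s = s"
begin

section \<open>Heisenberg relations and the span of an orbit\<close>

lemma psi_zero [simp]: "\<psi> 0 = 1"
  using psi_add[of 0 0] psi_nonzero[of 0] by simp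

lemma psi_uminus: "\<psi> (- x) = inverse (\<psi> x)"
  using psi_add[of x "- x"] by (simp add: inverse_unique)

lemma half_add_half: "x / 2 + x / 2 = (x :: 'f)"
  using two by (simp add: field_simps)

lemma diff_half: "x - x / 2 = (x / 2 :: 'f)"
  using half_add_half[of x] by (metis add_diff_cancel_right')

lemma B_linear:
  "Vector_Spaces.linear scW (*) (B w)" "Vector_Spaces.linear scW (*) (\<lambda>w'. B w' w)"
  using form by (simp_all add: symplectic_form_def)

lemma B_add [simp]: "B w (x + y) = B w x + B w y" "B (x + y) w = B x w + B y w"
  and B_scale [simp]: "B w (scW c x) = c * B w x" "B (scW c x) w = c * B x w"
  and B_zero [simp]: "B w 0 = 0" "B 0 w = 0"
proof -
  interpret R: Vector_Spaces.linear scW "(*)" "B w"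
    by (rule B_linear)
  interpret L: Vector_Spaces.linear scW "(*)" "\<lambda>w'. B w' w"
    by (rule B_linear)
  show "B w (x + y) = B w x + B w y" "B (x + y) w = B x w + B y w"
    "B w (scW c x) = c * B w x" "B (scW c x) w = c * B x w" "B w 0 = 0" "B 0 w = 0"
    by (rule R.add L.add R.scale L.scale R.zero L.zero)+
qed

lemma B_self [simp]: "B w w = 0"
  using form by (simp add: symplectic_form_def)

lemma B_swap: "B w' w = - B w w'"
  using B_self[of "w + w'"] by (simp only: B_add) (simp add: eq_neg_iff_add_eq_0 add.commute)

lemma P_add: "P w (x + y) = P w x + P w y"
  and P_scale: "P w (scS c x) = scS c (P w x)"
  and P_vec_zero [simp]: "P w 0 = 0"
proof -
  interpret Vector_Spaces.linear scS scS "P w"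
    by (rule P_linear)
  show "P w (x + y) = P w x + P w y" "P w (scS c x) = scS c (P w x)" "P w 0 = 0"
    by (rule add scale zero)+
qed

lemma P_eq_0_iff [simp]: "P w s = 0 \<longleftrightarrow> s = 0"
proof
  assume "P w s = 0"
  then have "P (- w) (P w s) = 0"
    by simp
  then show "s = 0"
    by (simp only: P_mult) simp
qed simp

lemma P_add_arg: "P (w + w') s = scS (\<psi> (- (B w w' / 2))) (P w (P w' s))"
  by (simp add: P_mult psi_add[symmetric])

lemma P_commute: "P w (P w' s) = scS (\<psi> (B w w')) (P w' (P w s))"
proof -
  have half: "B w w' + - (B w w' / 2) = B w w' / 2"
    by (simp only: add_uminus_conv_diff diff_half)
  have "scS (\<psi> (B w w')) (P w' (P w s)) = scS (\<psi> (B w w' + - (B w w' / 2))) (P (w + w') s)"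
    by (simp only: P_mult B_swap[of w' w] psi_add S.scale_scale minus_divide_left add.commute[of w' w])
  then show ?thesis
    unfolding half by (simp add: P_mult)
qed

lemma P_span_stable:
  assumes "s \<in> S.span (range (\<lambda>w. P w s0))"
  shows "P w s \<in> S.span (range (\<lambda>w. P w s0))"
  using assms
proof (induction rule: S.span_induct_alt)
  case base
  show ?case
    by (simp add: S.span_zero)
next
  case (step c x y)
  then obtain w' where "x = P w' s0"
    by blast
  then show ?case
    using step by (auto simp: P_add P_scale P_mult intro!: S.span_add S.span_scale intro: S.span_base)
qed

lemma orbit_span:
  assumes "s0 \<noteq> 0"
  shows "S.span (range (\<lambda>w. P w s0)) = UNIV"
proof -
  let ?U = "S.span (range (\<lambda>w. P w s0))"
  have "P 0 s0 \<in> ?U"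
    by (intro S.span_base rangeI)
  moreover have "?U = {0} \<or> ?U = UNIV"
    using P_span_stable by (intro irreducible S.subspace_span) blast
  ultimately show ?thesis
    using assms by auto
qed

section \<open>Eigenspaces of the operators along a line\<close>

definition eigenspace :: "'w \<Rightarrow> real \<Rightarrow> 'f \<Rightarrow> 's set" where
  "eigenspace u r a = {s. \<forall>x. v x \<le> r \<longrightarrow> P (scW x u) s = scS (\<psi> (x * a)) s}"

lemma eigenspaceD: "s \<in> eigenspace u r a \<Longrightarrow> v x \<le> r \<Longrightarrow> P (scW x u) s = scS (\<psi> (x * a)) s"
  by (simp add: eigenspace_def)

text \<open>Moving \<open>P w\<close> past \<open>P (scW x u)\<close> costs the factor
  \<open>\<psi> (x * B u w)\<close>. Hence every translate of a fixed vector (\<open>a = 0\<close>)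
  is an eigenvector.\<close>

lemma P_in_eigenspace:
  assumes "s \<in> eigenspace u r a"
  shows "P w s \<in> eigenspace u r (a + B u w)"
  unfolding eigenspace_def
proof (intro CollectI allI impI)
  fix x
  assume "v x \<le> r"
  then show "P (scW x u) (P w s) = scS (\<psi> (x * (a + B u w))) (P w s)"
    using eigenspaceD[OF assms]
    by (simp add: P_commute[of "scW x u" w] P_scale psi_add[symmetric] algebra_simps)
qed

lemma orbit_in_eigenspace:
  assumes "s0 \<in> eigenspace u r 0"
  shows "P w s0 \<in> eigenspace u r (B u w)"
  using P_in_eigenspace[OF assms, of w] by simp

text \<open>The dual of the ball of radius \<open>r\<close> under \<open>\<psi>\<close>. Two
  parameters give the same eigencharacter of the ball exactly when they differ by such an
  \<open>e\<close>, so the parameter of a nonzero eigenvector is determined only modulo this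
  set.\<close>

definition annihilates :: "real \<Rightarrow> 'f \<Rightarrow> bool" where
  "annihilates r e \<longleftrightarrow> (\<forall>x. v x \<le> r \<longrightarrow> \<psi> (x * e) = 1)"

text \<open>If \<open>\<psi> t \<noteq> 1\<close> and \<open>v e\<close> exceeded
  \<open>v t / r\<close>, then \<open>t / e\<close> would lie in the ball and detect
  \<open>e\<close>.\<close>

lemma annihilates_bounded:
  assumes "0 < r"
  obtains R where "0 < R" "\<And>e. annihilates r e \<Longrightarrow> v e \<le> R"
proof -
  obtain t where t: "\<psi> t \<noteq> 1"
    using psi_nontrivial by blast
  then have "t \<noteq> 0"
    by auto
  have "v e \<le> v t / r" if e: "annihilates r e" for e
  proof (rule ccontr)
    assume "\<not> v e \<le> v t / r"
    then have *: "v t < v e * r"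
      using assms by (simp add: field_simps)
    then have "e \<noteq> 0"
      using V.nonneg[of t] by auto
    then have "v (t / e) \<le> r"
      using * V.pos[of e] by (simp add: V.divide field_simps)
    then have "\<psi> (t / e * e) = 1"
      using e unfolding annihilates_def by blast
    then show False
      using t \<open>e \<noteq> 0\<close> by simp
  qed
  then show thesis
    using that[of "v t / r"] assms V.pos[OF \<open>t \<noteq> 0\<close>] by simp
qed

lemma eigenspace_unique:
  assumes "s \<in> eigenspace u r a" "s \<in> eigenspace u r a'" "s \<noteq> 0"
  shows "annihilates r (a' - a)"
  unfolding annihilates_def
proof (intro allI impI)
  fix x
  assume "v x \<le> r"
  then have "scS (\<psi> (x * a)) s = scS (\<psi> (x * a')) s"
    using assms eigenspaceD by metis
  then have "\<psi> (x * a) = \<psi> (x * a')"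
    using S.scale_left_imp_eq assms(3) by (metis S.scale_right_imp_eq)
  then show "\<psi> (x * (a' - a)) = 1"
    using psi_add[of "x * (a' - a)" "x * a"] psi_nonzero[of "x * a"]
    by (simp add: algebra_simps)
qed

text \<open>The conditions under which \<open>gauss c u a\<close> does not depend on the parameter
  \<open>a\<close> chosen for an eigencharacter; see \<open>gauss_cong\<close>.\<close>

definition small :: "real \<Rightarrow> 'f \<Rightarrow> bool" where
  "small r c \<longleftrightarrow> (\<forall>e. annihilates r e \<longrightarrow> v (c * e) \<le> r \<and> \<psi> (c * e * e / 2) = 1)"

lemma small_uminus: "small r (- c) \<longleftrightarrow> small r c"
  by (simp add: small_def psi_uminus)

lemma ex_small:
  assumes "0 < r"
  shows "\<exists>\<epsilon>>0. \<forall>c. v c \<le> \<epsilon> \<longrightarrow> small r c"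
proof -
  obtain R where R: "0 < R" "\<And>e. annihilates r e \<Longrightarrow> v e \<le> R"
    using annihilates_bounded[OF assms] by blast
  obtain d where d: "d > 0" "\<And>x. v x \<le> d \<Longrightarrow> \<psi> x = 1"
    using psi_ball by blast
  have v2: "0 < v 2"
    using V.pos[OF two] .
  \<comment> \<open>Given \<open>v e \<le> R\<close>, the first bound puts \<open>c * e\<close> into
    the ball of radius \<open>r\<close>, the second puts \<open>c * e * e / 2\<close> into the ball
    where \<open>\<psi>\<close> is trivial.\<close>
  define \<epsilon> where "\<epsilon> = min (r / R) (d * v 2 / (R * R))"
  have "0 < \<epsilon>"
    using R d v2 assms by (simp add: \<epsilon>_def)
  moreover have "small r c" if c: "v c \<le> \<epsilon>" for c
    unfolding small_def
  proof (intro allI impI conjI)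
    fix e
    assume "annihilates r e"
    then have e: "v e \<le> R"
      by (rule R)
    have "v c * v e \<le> r / R * R"
      using c e R V.nonneg[of c] V.nonneg[of e] assms
      by (intro mult_mono) (auto simp: \<epsilon>_def)
    then show "v (c * e) \<le> r"
      using R by (simp add: V.mult)
    have "v c * (v e * v e) \<le> d * v 2 / (R * R) * (R * R)"
      using c e R d v2 V.nonneg[of c] V.nonneg[of e] assms
      by (intro mult_mono) (auto simp: \<epsilon>_def)
    then have "v (c * e * e / 2) \<le> d"
      using R v2 by (simp add: V.mult V.divide field_simps)
    then show "\<psi> (c * e * e / 2) = 1"
      by (rule d)
  qed
  ultimately show ?thesis
    by blast
qed

section \<open>Lifting transvections\<close>

text \<open>\<open>gauss c u a\<close> is the action on the eigenspace of \<open>a\<close> of a lift of the transvection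
  \<open>w \<mapsto> w - c B(u,w) u\<close>: formally, up to a scalar, that lift is \<open>\<integral> \<psi>(-x\<^sup>2/(2c)) \<rho>(x u, 0) dx\<close>.\<close>

definition gauss :: "'f \<Rightarrow> 'w \<Rightarrow> 'f \<Rightarrow> 's \<Rightarrow> 's" where
  "gauss c u a s = scS (\<psi> (- (c * a * a / 2))) (P (scW (c * a) u) s)"

lemma gauss_linear:
  "gauss c u a (x + y) = gauss c u a x + gauss c u a y"
  "gauss c u a (scS k x) = scS k (gauss c u a x)"
  by (simp_all add: gauss_def P_add P_scale S.scale_right_distrib mult.commute)

lemma gauss_0 [simp]: "gauss c u a 0 = 0" "gauss c u 0 s = s"
  by (simp_all add: gauss_def)

lemma P_scale_add: "P (scW (x + y) u) s = P (scW x u) (P (scW y u) s)"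
  by (simp add: P_mult W.scale_left_distrib)

text \<open>Expand the square for \<open>a' = a + e\<close>: the cross term \<open>c * e * a\<close>
  cancels against the action of \<open>P (scW (c * e) u)\<close>, and the remaining phase
  \<open>c * e * e / 2\<close> is trivial by \<open>small\<close>.\<close>

lemma gauss_cong:
  assumes "s \<in> eigenspace u r a" "s \<in> eigenspace u r a'" "small r c"
  shows "gauss c u a s = gauss c u a' s"
proof (cases "s = 0")
  case False
  define e where "e = a' - a"
  have a': "a' = a + e"
    by (simp add: e_def)
  have "annihilates r e"
    using eigenspace_unique[OF assms(1,2) False] by (simp add: e_def)
  then have e: "v (c * e) \<le> r" "\<psi> (c * e * e / 2) = 1"
    using assms(3) by (auto simp: small_def)
  have square: "c * a' * a' / 2 = c * a * a / 2 + c * e * a + c * e * e / 2"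
    using two unfolding a' by (simp add: field_simps)
  have exponent: "- (c * a' * a' / 2) + c * e * a = - (c * a * a / 2) + - (c * e * e / 2)"
    unfolding square by simp
  have "gauss c u a' s = scS (\<psi> (- (c * a' * a' / 2))) (P (scW (c * a) u) (P (scW (c * e) u) s))"
    unfolding gauss_def P_scale_add[symmetric] a' by (simp add: algebra_simps)
  also have "\<dots> = scS (\<psi> (- (c * a' * a' / 2)) * \<psi> (c * e * a)) (P (scW (c * a) u) s)"
    using eigenspaceD[OF assms(1) e(1)] by (simp add: P_scale)
  also have "\<dots> = gauss c u a s"
    unfolding psi_add[symmetric] exponent unfolding psi_add
    by (simp add: gauss_def psi_uminus e)
  finally show ?thesis ..
qed simp

lemma gauss_in_eigenspace:
  assumes "s \<in> eigenspace u r a"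
  shows "gauss c u a s \<in> eigenspace u r a"
  using P_in_eigenspace[OF assms, of "scW (c * a) u"]
  by (simp add: eigenspace_def gauss_def P_scale mult.commute)

text \<open>The intertwining relation on a single eigenspace: the inverse of the transvection sends
  \<open>w\<close> to \<open>w + scW (c * B u w) u\<close>.\<close>

lemma gauss_P:
  "gauss c u (a + B u w) (P w s) = P (w + scW (c * B u w) u) (gauss c u a s)"
proof -
  define h where "h = B u w"
  define y where "y = P (scW (c * a) u) s"
  \<comment> \<open>The term \<open>c * a * h\<close> comes from commuting
    \<open>P (scW (c * a) u)\<close> past \<open>P w\<close>, the term \<open>c * h * h / 2\<close>
    from merging \<open>P (scW (c * h) u)\<close> with \<open>P w\<close>.\<close>
  have exponent: "c * a * h + c * h * h / 2 - c * (a + h) * (a + h) / 2 = - (c * a * a / 2)"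
    using two by (simp add: field_simps)
  have "gauss c u (a + h) (P w s) =
      scS (\<psi> (- (c * (a + h) * (a + h) / 2))) (P (scW (c * h) u) (P (scW (c * a) u) (P w s)))"
    unfolding gauss_def P_scale_add[symmetric] by (simp add: algebra_simps)
  also have "P (scW (c * a) u) (P w s) = scS (\<psi> (c * a * h)) (P w y)"
    unfolding y_def h_def by (subst P_commute) simp
  also have "P (scW (c * h) u) (scS (\<psi> (c * a * h)) (P w y)) =
      scS (\<psi> (c * a * h + c * h * h / 2)) (P (scW (c * h) u + w) y)"
    by (simp add: P_scale P_mult psi_add h_def[symmetric])
  finally show ?thesis
    by (simp add: h_def[symmetric] psi_add[symmetric] exponent gauss_def P_scale y_def add.commute)
qed

text \<open>The formula is imposed on a basis taken from the orbit. It persists on every eigenspace,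
  because an eigenvector is a combination of basis vectors with the same eigencharacter.\<close>

lemma ex_gauss_operator:
  assumes s0: "s0 \<noteq> 0" "s0 \<in> eigenspace u r 0" and small: "small r c"
  obtains M where "Vector_Spaces.linear scS scS M"
    "\<And>a s. s \<in> eigenspace u r a \<Longrightarrow> M s = gauss c u a s"
proof -
  obtain C where C: "C \<subseteq> range (\<lambda>w. P w s0)" "S.independent C" "range (\<lambda>w. P w s0) \<subseteq> S.span C"
    using S.maximal_independent_subset .
  have span: "S.span C = UNIV"
    using orbit_span[OF s0(1)] S.span_minimal[OF C(3)] by auto
  interpret SS: vector_space_pair scS scS ..
  \<comment> \<open>The arbitrary choice of a parameter for each basis vector is harmless by
    \<open>gauss_cong\<close>.\<close>
  obtain M where lin: "Vector_Spaces.linear scS scS M"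
    and M: "\<And>x. x \<in> C \<Longrightarrow> M x = gauss c u (SOME a. x \<in> eigenspace u r a) x"
    using SS.linear_independent_extend[OF C(2), of "\<lambda>x. gauss c u (SOME a. x \<in> eigenspace u r a) x"]
    by blast
  interpret M: Vector_Spaces.linear scS scS M
    by (rule lin)
  have "M s = gauss c u a s" if s: "s \<in> eigenspace u r a" for a s
  proof -
    have eig: "\<exists>l. P (scW x u) y = scS l y" if "x \<in> {x. v x \<le> r}" "y \<in> C" for x y
      using C(1) that orbit_in_eigenspace[OF s0(2)] eigenspaceD by blast
    have "s \<in> S.span {y \<in> C. \<forall>x\<in>{x. v x \<le> r}. P (scW x u) y = scS (\<psi> (x * a)) y}"
      by (rule S.joint_eigenvector_in_span[OF P_linear eig]) (use span eigenspaceD[OF s] in auto)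
    then show ?thesis
    proof (induction rule: S.span_induct_alt)
      case base
      show ?case
        by (simp add: M.zero)
    next
      case (step k y z)
      then have y: "y \<in> C" "y \<in> eigenspace u r a"
        by (auto simp: eigenspace_def)
      then have "M y = gauss c u a y"
        using M gauss_cong[OF _ y(2) small] by (metis someI)
      then show ?case
        using step.IH by (simp add: M.add M.scale gauss_linear)
    qed
  qed
  then show thesis
    using that lin by blast
qed

lemma gauss_inverse:
  assumes "s \<in> eigenspace u r a"
  shows "gauss (- c) u a (gauss c u a s) = s"
proof -
  have "P (scW (- c * a) u) (P (scW (c * a) u) s) = s"
    unfolding P_scale_add[symmetric] by simp
  then show ?thesis
    by (simp add: gauss_def P_scale psi_add[symmetric])
qed

text \<open>A lift of the transvection, expressed through its inverse as in the defining relation of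
  the metaplectic group. The last clause normalises it to be the identity on the eigenspace of
  0.\<close>

definition transvection_operator :: "'w \<Rightarrow> real \<Rightarrow> 'f \<Rightarrow> ('s \<Rightarrow> 's) \<Rightarrow> bool" where
  "transvection_operator u r c M \<longleftrightarrow>
     Vector_Spaces.linear scS scS M \<and> bij M \<and>
     (\<forall>w s. M (P w s) = P (w + scW (c * B u w) u) (M s)) \<and>
     (\<forall>a. \<forall>s\<in>eigenspace u r a. M s = gauss c u a s)"

text \<open>The operators for \<open>c\<close> and \<open>- c\<close> invert each other because
  \<open>gauss\<close> does so on each eigenspace. This and the intertwining relation are checked on
  orbit vectors, which span.\<close>

lemma ex_transvection_operator:
  assumes s0: "s0 \<noteq> 0" "s0 \<in> eigenspace u r 0" and small: "small r c"
  shows "\<exists>M. transvection_operator u r c M"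
proof -
  have ind: "Q s" if "Q 0" "\<And>k w y. Q y \<Longrightarrow> Q (scS k (P w s0) + y)" for Q and s :: 's
  proof -
    have "s \<in> S.span (range (\<lambda>w. P w s0))"
      using orbit_span[OF s0(1)] by simp
    then show ?thesis
      by (induction rule: S.span_induct_alt) (use that in auto)
  qed
  have inverse: "M' (M s) = s"
    if M: "Vector_Spaces.linear scS scS M" "\<And>a s. s \<in> eigenspace u r a \<Longrightarrow> M s = gauss c u a s"
      and M': "Vector_Spaces.linear scS scS M'"
        "\<And>a s. s \<in> eigenspace u r a \<Longrightarrow> M' s = gauss (- c) u a s" for M M' c s
  proof -
    interpret M: Vector_Spaces.linear scS scS M by (rule M)
    interpret M': Vector_Spaces.linear scS scS M' by (rule M')
    show ?thesis
    proof (induction s rule: ind)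
      case (2 k w y)
      have "M' (M (P w s0)) = P w s0"
        using M M' orbit_in_eigenspace[OF s0(2), of w] gauss_in_eigenspace gauss_inverse by metis
      then show ?case
        using 2 by (simp add: M.add M.scale M'.add M'.scale)
    qed (simp add: M.zero M'.zero)
  qed
  obtain M where M: "Vector_Spaces.linear scS scS M"
      "\<And>a s. s \<in> eigenspace u r a \<Longrightarrow> M s = gauss c u a s"
    using ex_gauss_operator[OF s0 small] by blast
  have small': "small r (- c)"
    using small by (simp add: small_uminus)
  obtain M' where M': "Vector_Spaces.linear scS scS M'"
      "\<And>a s. s \<in> eigenspace u r a \<Longrightarrow> M' s = gauss (- c) u a s"
    using ex_gauss_operator[OF s0 small'] by blast
  interpret M: Vector_Spaces.linear scS scS M by (rule M)
  have "bij M"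
    by (rule o_bij[of M']) (use inverse[OF M M'] inverse[OF M', of M] M in \<open>auto simp: fun_eq_iff\<close>)
  moreover have "M (P w s) = P (w + scW (c * B u w) u) (M s)" for w s
  proof (induction s rule: ind)
    case 1
    show ?case
      by (simp add: M.zero)
  next
    case (2 k w' y)
    have "P w' s0 \<in> eigenspace u r (B u w')"
      by (rule orbit_in_eigenspace[OF s0(2)])
    then have "M (P w (P w' s0)) = P (w + scW (c * B u w) u) (M (P w' s0))"
      using M(2) P_in_eigenspace gauss_P by metis
    then show ?case
      using 2 by (simp add: M.add M.scale P_add P_scale)
  qed
  ultimately show ?thesis
    using M unfolding transvection_operator_def by blast
qed

section \<open>Vectors fixed by small transvection lifts\<close>

lemma eigenspace_mono: "r' \<le> r \<Longrightarrow> eigenspace u r a \<subseteq> eigenspace u r' a"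
  by (auto simp: eigenspace_def)

text \<open>The eigenvalue \<open>\<psi> (c a\<^sup>2 / 2)\<close> of the operators for small \<open>c\<close> oscillates on eigenspaces
  with large \<open>a\<close>, so such eigenspaces do not contribute to a vector fixed by these operators. A
  minimal set of orbit vectors spanning \<open>s\<close> isolates the contributing eigenspaces.\<close>

lemma transvection_invariants:
  assumes "0 < r" "0 < \<epsilon>" and s0: "s0 \<noteq> 0" "s0 \<in> eigenspace u r 0"
    and small: "\<And>c. v c \<le> \<epsilon> \<Longrightarrow> small r c"
  shows "\<exists>\<delta>>0. \<forall>s. (\<forall>c M. v c \<le> \<epsilon> \<longrightarrow> transvection_operator u r c M \<longrightarrow> M s = s) \<longrightarrow>
    s \<in> eigenspace u \<delta> 0"
proof -
  obtain R where R: "0 < R" "\<And>e. annihilates r e \<Longrightarrow> v e \<le> R"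
    using annihilates_bounded[OF \<open>0 < r\<close>] by blast
  obtain d where d: "0 < d" "\<And>x. v x \<le> d \<Longrightarrow> \<psi> x = 1"
    using psi_ball by blast
  \<comment> \<open>Thresholds for \<open>v a\<close>: above \<open>r / \<epsilon>\<close>, every
    \<open>c\<close> with \<open>v c \<le> r / v a\<close> is admissible; above
    \<open>v 2 * R\<close>, the element \<open>a / 2\<close> is too large to annihilate the
    ball.\<close>
  define K where "K = max (r / \<epsilon>) (v 2 * R)"
  \<comment> \<open>For \<open>v x \<le> \<delta>\<close> and \<open>v (B u w) \<le> K\<close>, the
    product \<open>x * B u w\<close> stays where \<open>\<psi>\<close> is trivial.\<close>
  define \<delta> where "\<delta> = min r (d / K)"
  have "0 < K"
    using assms(1,2) by (simp add: K_def less_max_iff_disj)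
  then have "0 < \<delta>"
    using assms d by (simp add: \<delta>_def)
  have "s \<in> eigenspace u \<delta> 0"
    if fixed: "\<And>c M. v c \<le> \<epsilon> \<Longrightarrow> transvection_operator u r c M \<Longrightarrow> M s = s" for s
  proof -
    let ?spans = "\<lambda>J. finite J \<and> s \<in> S.span ((\<lambda>w. P w s0) ` J)"
    have "s \<in> S.span (range (\<lambda>w. P w s0))"
      using orbit_span[OF s0(1)] by simp
    then obtain F where "finite F" "F \<subseteq> range (\<lambda>w. P w s0)" "s \<in> S.span F"
      unfolding S.span_explicit by blast
    then have "\<exists>J. ?spans J"
      by (metis finite_subset_image)
    \<comment> \<open>Minimality will ensure that no orbit vector indexed by \<open>J\<close> can be
      discarded.\<close>
    then obtain J where J: "?spans J" and minimal: "\<And>J'. ?spans J' \<Longrightarrow> card J \<le> card J'"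
      using ex_has_least_nat[of ?spans _ card] by blast
    have bound: "v (B u w) \<le> K" if "w \<in> J" for w
    proof -
      have "finite ((\<lambda>w. v (B u w)) ` J)" "(\<lambda>w. v (B u w)) ` J \<noteq> {}"
        using J that by auto
      \<comment> \<open>The index with the largest pairing is tested: one range of \<open>c\<close>
        then keeps \<open>c * B u w\<close> in the ball of radius \<open>r\<close> for all
        \<open>w\<close> in \<open>J\<close>.\<close>
      then obtain w0 where "w0 \<in> J" "Max ((\<lambda>w. v (B u w)) ` J) = v (B u w0)"
        using Max_in by blast
      then have w0: "w0 \<in> J" "\<And>w. w \<in> J \<Longrightarrow> v (B u w) \<le> v (B u w0)"
        using \<open>finite ((\<lambda>w. v (B u w)) ` J)\<close> by (auto dest: Max_ge)
      define a where "a = B u w0"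
      have "v a \<le> K"
      proof (rule ccontr)
        assume "\<not> v a \<le> K"
        then have large: "r / \<epsilon> < v a" "v 2 * R < v a"
          by (auto simp: K_def)
        moreover have "0 < r / \<epsilon>"
          using assms(1,2) by simp
        ultimately have a: "0 < v a" "a \<noteq> 0"
          by auto
        have eta: "r / v a < \<epsilon>"
          using large a assms(2) by (simp add: field_simps)
        define I where "I = {c. v c \<le> r / v a}"
        have "\<exists>M. transvection_operator u r c M" if "c \<in> I" for c
          using that eta small by (intro ex_transvection_operator[OF s0]) (auto simp: I_def)
        then obtain M where M: "\<And>c. c \<in> I \<Longrightarrow> transvection_operator u r c (M c)"
          by metis
        \<comment> \<open>The operator \<open>P\<close> contributes the phase
          \<open>c * B u w * B u w\<close>, and the prefactor in \<open>gauss\<close> removes half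
          of it.\<close>
        have eig: "M c (P w s0) = scS (\<psi> (c * B u w * B u w / 2)) (P w s0)"
          if "c \<in> I" "w \<in> J" for c w
        proof -
          let ?h = "B u w"
          have mem: "P w s0 \<in> eigenspace u r ?h"
            by (rule orbit_in_eigenspace[OF s0(2)])
          have "v c * v ?h \<le> r / v a * v a"
            using that w0 V.nonneg a assms(1) unfolding I_def a_def
            by (intro mult_mono) auto
          then have "v (c * ?h) \<le> r"
            using a by (simp add: V.mult)
          then have "P (scW (c * ?h) u) (P w s0) = scS (\<psi> (c * ?h * ?h)) (P w s0)"
            by (rule eigenspaceD[OF mem])
          moreover have "M c (P w s0) = gauss c u ?h (P w s0)"
            using M[OF that(1)] mem unfolding transvection_operator_def by blast
          ultimately show ?thesis
            by (simp add: gauss_def psi_add[symmetric] diff_half)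
        qed
        \<comment> \<open>Since \<open>s\<close> is fixed, the orbit vectors with eigenvalue 1
          already span it, and minimality forces \<open>J' = J\<close>.\<close>
        define J' where "J' = {w \<in> J. \<forall>c\<in>I. M c (P w s0) = P w s0}"
        have "s \<in> S.span {x \<in> (\<lambda>w. P w s0) ` J. \<forall>c\<in>I. M c x = scS 1 x}"
        proof (rule S.joint_eigenvector_in_span)
          show "M c s = scS 1 s" if "c \<in> I" for c
            using fixed[OF _ M[OF that]] that eta by (simp add: I_def)
          show "Vector_Spaces.linear scS scS (M c)" if "c \<in> I" for c
            using M[OF that] by (simp add: transvection_operator_def)
        qed (use J eig in blast)+
        also have "{x \<in> (\<lambda>w. P w s0) ` J. \<forall>c\<in>I. M c x = scS 1 x} = (\<lambda>w. P w s0) ` J'"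
          by (auto simp: J'_def)
        finally have "card J \<le> card J'"
          using J by (intro minimal) (auto simp: J'_def)
        then have "J' = J"
          using J by (intro card_seteq) (auto simp: J'_def)
        then have scalar: "\<psi> (c * a * a / 2) = 1" if "c \<in> I" for c
        proof -
          have "M c (P w0 s0) = P w0 s0"
            using \<open>J' = J\<close> w0(1) that unfolding J'_def by blast
          then have "scS (\<psi> (c * a * a / 2)) (P w0 s0) = scS 1 (P w0 s0)"
            using eig[OF that w0(1)] by (simp add: a_def)
          then show ?thesis
            using s0(1) by (metis P_eq_0_iff S.scale_right_imp_eq)
        qed
        \<comment> \<open>Substituting \<open>c = x / a\<close> turns the quadratic phase into a
          character that is linear in \<open>x\<close>.\<close>
        have "annihilates r (a / 2)"
          unfolding annihilates_def
        proof (intro allI impI)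
          fix x
          assume "v x \<le> r"
          then have "x / a \<in> I"
            using a by (simp add: I_def V.divide divide_right_mono)
          then have "\<psi> (x / a * a * a / 2) = 1"
            by (rule scalar)
          then show "\<psi> (x * (a / 2)) = 1"
            using a by simp
        qed
        then have "v (a / 2) \<le> R"
          by (rule R)
        then show False
          using large V.pos[OF two] by (simp add: V.divide field_simps)
      qed
      then show ?thesis
        using w0 that unfolding a_def by (meson order_trans)
    qed
    show ?thesis
      unfolding eigenspace_def
    proof (intro CollectI allI impI)
      fix x
      assume x: "v x \<le> \<delta>"
      have "P (scW x u) y = y" if "y \<in> S.span ((\<lambda>w. P w s0) ` J)" for y
        using that
      proof (induction rule: S.span_induct_alt)
        case (step k y z)
        then obtain w where w: "w \<in> J" "y = P w s0"
          by blast
        have "v x * v (B u w) \<le> d / K * K"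
          using x bound[OF w(1)] V.nonneg \<open>0 < K\<close> d by (intro mult_mono) (auto simp: \<delta>_def)
        then have "\<psi> (x * B u w) = 1"
          using \<open>0 < K\<close> by (intro d) (simp add: V.mult)
        then have "P (scW x u) y = y"
          using eigenspaceD[OF orbit_in_eigenspace[OF s0(2)], of x w] x w by (simp add: \<delta>_def)
        then show ?case
          using step by (simp add: P_add P_scale)
      qed simp
      then show "P (scW x u) s = scS (\<psi> (x * 0)) s"
        using J by simp
    qed
  qed
  then show ?thesis
    using \<open>0 < \<delta>\<close> by blast
qed

section \<open>Vectors fixed by a lattice\<close>

lemma P_lattice_scalar:
  assumes "\<And>b. b \<in> Bs \<Longrightarrow> s0 \<in> eigenspace b \<delta> 0" "\<And>b. b \<in> Bs \<Longrightarrow> v (x b) \<le> \<delta>"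
  shows "\<exists>k. P (\<Sum>b\<in>Bs. scW (x b) b) s0 = scS k s0"
proof -
  have "\<exists>k. P (\<Sum>b\<in>A. scW (x b) b) s0 = scS k s0" if "finite A" "A \<subseteq> Bs" for A
    using that
  proof (induction A)
    case empty
    show ?case
      by (intro exI[of _ 1]) simp
  next
    case (insert b A)
    then obtain k where "P (\<Sum>b\<in>A. scW (x b) b) s0 = scS k s0"
      by auto
    moreover have "P (scW (x b) b) s0 = s0"
      using eigenspaceD[OF assms(1), of b "x b"] assms(2) insert by simp
    \<comment> \<open>Splitting off one coordinate costs a cocycle factor, so a sum of lattice
      generators acts on \<open>s0\<close> by a scalar that may differ from 1.\<close>
    ultimately show ?case
      using insert by (simp add: P_add_arg P_scale)
  qed
  then show ?thesis
    using W.finite_Basis by blast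
qed

text \<open>By nondegeneracy the pairings with \<open>Bs\<close> are injective coordinates, and
  \<open>G\<close> lists the dual basis. It turns bounds on pairings into bounds on vectors.\<close>

lemma dual_expansion: "\<exists>G. \<forall>w. w = (\<Sum>b\<in>Bs. scW (B b w) (G b))"
proof -
  define L where "L w = (\<Sum>b\<in>Bs. scW (B b w) b)" for w
  have lin: "Vector_Spaces.linear scW scW L"
    unfolding L_def
    by unfold_locales (simp_all add: W.scale_left_distrib sum.distrib W.scale_sum_right)
  interpret L: Vector_Spaces.linear scW scW L
    by (rule lin)
  interpret WW: vector_space_pair scW scW ..
  have "w = 0" if "L w = 0" for w
  proof -
    have basis: "B b w = 0" if b: "b \<in> Bs" for b
      using \<open>L w = 0\<close> b W.independent_Basis W.finite_Basis
      unfolding L_def W.independent_explicit by metis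
    have "B b w = 0" if "b \<in> W.span Bs" for b
      using that by (induction rule: W.span_induct_alt) (simp_all add: basis)
    then have "B w w' = 0" for w'
      using B_swap[of w w'] W.span_Basis by simp
    then show ?thesis
      using form by (simp add: symplectic_form_def)
  qed
  then have "inj L"
    unfolding L.inj_iff_eq_0 by blast
  then obtain G where G: "Vector_Spaces.linear scW scW G" "G \<circ> L = id"
    using WW.linear_injective_left_inverse[OF lin] by blast
  interpret G: Vector_Spaces.linear scW scW G
    by (rule G)
  have "w = (\<Sum>b\<in>Bs. scW (B b w) (G b))" for w
    using G(2) by (simp add: fun_eq_iff L_def G.sum G.scale)
  then show ?thesis
    by blast
qed

text \<open>Relative to one nonzero fixed vector \<open>s0\<close>, only translates
  \<open>P w s0\<close> that are themselves fixed can contribute, and up to scalars there are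
  finitely many of these.\<close>

lemma lattice_invariants_finite_dimensional:
  assumes "0 < \<delta>"
  shows "\<exists>Y. finite Y \<and> {s. \<forall>b\<in>Bs. s \<in> eigenspace b \<delta> 0} \<subseteq> S.span Y"
proof (cases "\<exists>s0. s0 \<noteq> 0 \<and> (\<forall>b\<in>Bs. s0 \<in> eigenspace b \<delta> 0)")
  case False
  then show ?thesis
    by (intro exI[of _ "{0}"]) auto
next
  case True
  then obtain s0 where s0: "s0 \<noteq> 0" "\<And>b. b \<in> Bs \<Longrightarrow> s0 \<in> eigenspace b \<delta> 0"
    by blast
  obtain R where R: "0 < R" "\<And>e. annihilates \<delta> e \<Longrightarrow> v e \<le> R"
    using annihilates_bounded[OF assms] by blast
  obtain G where G: "\<And>w. w = (\<Sum>b\<in>Bs. scW (B b w) (G b))"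
    using dual_expansion by blast
  define K where "K = (\<Sum>b\<in>Bs. \<Sum>b'\<in>Bs. v (W.representation Bs (G b) b'))"
  have "0 \<le> K"
    unfolding K_def by (intro sum_nonneg V.nonneg)
  have K: "v (W.representation Bs (G b) b') \<le> K" if "b \<in> Bs" "b' \<in> Bs" for b b'
  proof -
    have "v (W.representation Bs (G b) b') \<le> (\<Sum>b'\<in>Bs. v (W.representation Bs (G b) b'))"
      by (rule member_le_sum[OF that(2)]) (simp_all add: V.nonneg W.finite_Basis)
    also have "\<dots> \<le> K"
      unfolding K_def
      by (rule member_le_sum[OF that(1)]) (simp_all add: V.nonneg W.finite_Basis sum_nonneg)
    finally show ?thesis .
  qed
  \<comment> \<open>Here \<open>K\<close> bounds all coordinates of the dual basis. Knowing the
    pairings to precision \<open>\<eta>\<close> leaves an error vector with coordinates at most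
    \<open>\<eta> * K \<le> \<delta>\<close>, that is, in the lattice; \<open>1 +\<close> covers
    \<open>K = 0\<close>.\<close>
  define \<eta> where "\<eta> = \<delta> / (1 + K)"
  have "0 < \<eta>"
    using assms \<open>0 \<le> K\<close> by (simp add: \<eta>_def)
  then obtain X where X: "finite X" "\<And>x. v x \<le> R \<Longrightarrow> \<exists>y\<in>X. v (x - y) \<le> \<eta>"
    using covering by blast
  \<comment> \<open>One representative for each choice of approximate pairings; extensional
    functions keep the index set finite.\<close>
  define Y where "Y = (\<lambda>y. P (\<Sum>b\<in>Bs. scW (y b) (G b)) s0) ` (Bs \<rightarrow>\<^sub>E X)"
  have "finite Y"
    unfolding Y_def by (intro finite_imageI finite_PiE) (simp_all add: X W.finite_Basis)
  have orbit: "P w s0 \<in> S.span Y" if w: "\<And>b. b \<in> Bs \<Longrightarrow> annihilates \<delta> (B b w)" for w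
  proof -
    have "\<forall>b\<in>Bs. \<exists>y\<in>X. v (B b w - y) \<le> \<eta>"
      using X(2) R(2) w by blast
    then obtain y0 where y0: "\<And>b. b \<in> Bs \<Longrightarrow> y0 b \<in> X" "\<And>b. b \<in> Bs \<Longrightarrow> v (B b w - y0 b) \<le> \<eta>"
      by metis
    define y where "y = restrict y0 Bs"
    have y: "y \<in> Bs \<rightarrow>\<^sub>E X" "\<And>b. b \<in> Bs \<Longrightarrow> v (B b w - y b) \<le> \<eta>"
      using y0 by (auto simp: y_def)
    define w' where "w' = (\<Sum>b\<in>Bs. scW (y b) (G b))"
    define l where "l = (\<Sum>b\<in>Bs. scW (B b w - y b) (G b))"
    have w_eq: "w = w' + l"
      using G[of w] by (simp add: w'_def l_def sum.distrib[symmetric] W.scale_left_distrib[symmetric])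
    have "v (W.representation Bs l b') \<le> \<delta>" if b': "b' \<in> Bs" for b'
    proof -
      have "W.representation Bs l b' = (\<Sum>b\<in>Bs. (B b w - y b) * W.representation Bs (G b) b')"
        unfolding l_def
        by (simp add: W.representation_sum W.representation_scale W.independent_Basis W.span_Basis)
      also have "v \<dots> \<le> \<eta> * K"
        using y(2) K b' V.nonneg \<open>0 < \<eta>\<close> \<open>0 \<le> K\<close>
        by (intro V.sum_le) (auto simp: V.mult intro!: mult_mono)
      also have "\<dots> \<le> \<delta>"
        using assms \<open>0 \<le> K\<close> by (simp add: \<eta>_def field_simps)
      finally show ?thesis .
    qed
    then obtain k where k: "P (\<Sum>b\<in>Bs. scW (W.representation Bs l b) b) s0 = scS k s0"
      using P_lattice_scalar[OF s0(2)] by blast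
    have "(\<Sum>b\<in>Bs. scW (W.representation Bs l b) b) = l"
      by (rule W.sum_representation_eq)
        (simp_all add: W.independent_Basis W.span_Basis W.finite_Basis)
    then have "P w s0 = scS (\<psi> (- (B w' l / 2)) * k) (P w' s0)"
      using k by (simp add: w_eq P_add_arg P_scale)
    moreover have "P w' s0 \<in> Y"
      using y(1) unfolding Y_def w'_def by blast
    ultimately show ?thesis
      by (simp add: S.span_base S.span_scale)
  qed
  have "s \<in> S.span Y" if s: "\<And>b. b \<in> Bs \<Longrightarrow> s \<in> eigenspace b \<delta> 0" for s
  proof -
    let ?I = "Bs \<times> {x. v x \<le> \<delta>}"
    let ?T = "\<lambda>(b, x). P (scW x b)"
    have eig: "P (scW x b) (P w s0) = scS (\<psi> (x * B b w)) (P w s0)"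
      if "b \<in> Bs" "v x \<le> \<delta>" for b x w
      using eigenspaceD[OF orbit_in_eigenspace[OF s0(2)]] that by blast
    \<comment> \<open>All operators along all basis lines are used at once, each with eigenvalue
      1.\<close>
    have "s \<in> S.span {y \<in> range (\<lambda>w. P w s0). \<forall>i\<in>?I. ?T i y = scS 1 y}"
    proof (rule S.joint_eigenvector_in_span)
      show "Vector_Spaces.linear scS scS (?T i)" for i
        by (cases i) (simp add: P_linear)
      show "\<exists>l. ?T i y = scS l y" if iy: "i \<in> ?I" "y \<in> range (\<lambda>w. P w s0)" for i y
      proof -
        obtain b x w where "i = (b, x)" "b \<in> Bs" "v x \<le> \<delta>" "y = P w s0"
          using iy by auto
        then show ?thesis
          using eig[of b x w] by auto
      qed
      show "?T i s = scS 1 s" if "i \<in> ?I" for i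
        using that eigenspaceD[OF s] by (cases i) simp
      show "s \<in> S.span (range (\<lambda>w. P w s0))"
        by (simp add: orbit_span[OF s0(1)])
    qed
    moreover have "{y \<in> range (\<lambda>w. P w s0). \<forall>i\<in>?I. ?T i y = scS 1 y} \<subseteq> S.span Y"
    proof clarify
      fix w
      assume fixed: "\<forall>i\<in>?I. ?T i (P w s0) = scS 1 (P w s0)"
      have "annihilates \<delta> (B b w)" if "b \<in> Bs" for b
        unfolding annihilates_def
      proof (intro allI impI)
        fix x
        assume "v x \<le> \<delta>"
        then have "scS (\<psi> (x * B b w)) (P w s0) = scS 1 (P w s0)"
          using fixed eig[OF that, of x w] that by force
        then show "\<psi> (x * B b w) = 1"
          using s0(1) by (metis P_eq_0_iff S.scale_right_imp_eq)
      qed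
      then show "P w s0 \<in> S.span Y"
        by (rule orbit)
    qed
    ultimately show ?thesis
      using S.span_minimal[OF _ S.subspace_span] by blast
  qed
  then show ?thesis
    using \<open>finite Y\<close> by blast
qed

section \<open>Transvection lifts in a neighbourhood of the identity\<close>

lemma smooth_finite:
  assumes "finite Z" "u \<in> Bs"
  shows "\<exists>r>0. Z \<subseteq> eigenspace u r 0"
  using assms(1)
proof (induction Z)
  case empty
  show ?case
    by (intro exI[of _ 1]) simp
next
  case (insert z Z)
  then obtain r where r: "0 < r" "Z \<subseteq> eigenspace u r 0"
    by blast
  obtain r' where r': "0 < r'" "z \<in> eigenspace u r' 0"
    using smooth[OF assms(2), of z] by (auto simp: eigenspace_def)
  have "insert z Z \<subseteq> eigenspace u (min r r') 0"
    using r r' eigenspace_mono[of "min r r'" r] eigenspace_mono[of "min r r'" r'] min.cobounded1 min.cobounded2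
    by blast
  then show ?case
    using r r' by (intro exI[of _ "min r r'"]) simp
qed

definition transvection :: "'w \<Rightarrow> 'f \<Rightarrow> 'w \<Rightarrow> 'w" where
  "transvection u c w = w - scW (c * B u w) u"

lemma B_diff [simp]: "B w (x - y) = B w x - B w y" "B (x - y) w = B x w - B y w"
  using B_add(1)[of w "x - y" y] B_add(2)[of "x - y" y w] by (simp_all add: algebra_simps)

lemma transvection_uminus: "transvection u (- c) (transvection u c w) = w"
  by (simp add: transvection_def)

lemma transvection_bij: "bij (transvection u c)"
  using transvection_uminus[of u c] transvection_uminus[of u "- c"]
  by (intro o_bij[of "transvection u (- c)"]) (simp_all add: fun_eq_iff)

lemma inv_transvection: "inv_into UNIV (transvection u c) = transvection u (- c)"
  using transvection_uminus[of u "- c"] by (intro inv_equality transvection_uminus) simp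

lemma transvection_Sp: "transvection u c \<in> carrier (Sp scW B)"
proof -
  have "Vector_Spaces.linear scW scW (transvection u c)"
    unfolding transvection_def
    by unfold_locales (simp_all add: W.scale_left_distrib W.scale_right_diff_distrib algebra_simps)
  moreover have "B (transvection u c w) (transvection u c w') = B w w'" for w w'
    by (simp add: transvection_def B_swap[of w u])
  ultimately show ?thesis
    by (simp add: Sp_def GL_def transvection_bij)
qed

text \<open>The inverse transvection built into \<open>transvection_operator\<close> matches the
  \<open>inv_into\<close> of \<open>Sp_tilde_carrier\<close>; the central coordinate acts by a
  scalar, which passes through \<open>M\<close>.\<close>

lemma transvection_lift:
  assumes rho: "\<And>w t s. \<rho> (w, t) s = scS (\<psi> t) (P w s)"
    and M: "transvection_operator u r c M"
  shows "(transvection u c, M) \<in> Sp_tilde_carrier scW B scS \<rho>"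
proof -
  have "M (\<rho> (w, t) (inv_into UNIV M s)) = \<rho> (transvection u (- c) w, t) s" for w t s
  proof -
    interpret M: Vector_Spaces.linear scS scS M
      using M by (simp add: transvection_operator_def)
    have "M (inv_into UNIV M s) = s"
      using M by (simp add: transvection_operator_def bij_is_surj surj_f_inv_f)
    then show ?thesis
      using M by (simp add: rho M.scale transvection_operator_def transvection_def)
  qed
  then show ?thesis
    using M transvection_Sp[of u c]
    by (simp add: Sp_tilde_carrier_def inv_transvection fun_eq_iff GL_def transvection_operator_def)
qed

text \<open>The matrix entries are affine functions of \<open>c\<close>.\<close>

lemma continuous_map_transvection:
  assumes T: "T = Metric_space.mtopology UNIV (\<lambda>x y. v (x - y))"
  shows "continuous_map T (Sp_topology T scW Bs B) (transvection u)"
  unfolding Sp_topology_def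
proof (rule continuous_map_pullback')
  have "continuous_map T T (\<lambda>c. W.representation Bs (transvection u c b') b)" for b b'
    using V.continuous_map_affine[of "W.representation Bs b' b" "- (B u b' * W.representation Bs u b)"]
    by (simp add: T transvection_def W.representation_diff W.representation_scale
        W.independent_Basis W.span_Basis mult.assoc)
  then show "continuous_map T (product_topology (\<lambda>_. T) (Bs \<times> Bs))
      ((\<lambda>g. \<lambda>(b, b')\<in>Bs \<times> Bs. W.representation Bs (g b') b) \<circ> transvection u)"
    by (auto simp add: continuous_map_componentwise o_def image_subset_iff)
qed (simp add: transvection_Sp subset_iff)

lemma open_invariants:
  assumes T: "T = Metric_space.mtopology UNIV (\<lambda>x y. v (x - y))"
    and rho: "\<And>w t s. \<rho> (w, t) s = scS (\<psi> t) (P w s)"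
    and N: "openin (ext_topology (Sp_tilde T scW Bs B scS \<rho>)) N" "(id, id) \<in> N"
    and "u \<in> Bs" and s0: "s0 \<noteq> (0 :: 's)"
  shows "\<exists>\<delta>>0. {s. \<forall>(g, M)\<in>N. M s = s} \<subseteq> eigenspace u \<delta> 0"
proof -
  obtain O' where O': "openin (prod_topology (Sp_topology T scW Bs B) (GL_topology scS)) O'"
      "N = O' \<inter> Sp_tilde_carrier scW B scS \<rho>"
    using N(1) by (auto simp: Sp_tilde_def openin_subtopology)
  then obtain U V where UV: "openin (Sp_topology T scW Bs B) U" "openin (GL_topology scS) V"
      "id \<in> U" "id \<in> V" "U \<times> V \<subseteq> O'"
    using N(2) unfolding openin_prod_topology_alt by (metis IntD1)
  obtain Z where Z: "finite Z" "\<And>f. f \<in> carrier (GL scS) \<Longrightarrow> (\<And>z. z \<in> Z \<Longrightarrow> f z = z) \<Longrightarrow> f \<in> V"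
    using GL_topology_pointwise[OF UV(2,4)] by auto
  \<comment> \<open>Lifts built with this \<open>r\<close> fix every vector of \<open>Z\<close>,
    since \<open>gauss\<close> is the identity on the eigenspace of 0. Including \<open>s0\<close>
    provides the spanning orbit on which the lifts are constructed.\<close>
  obtain r where r: "0 < r" "insert s0 Z \<subseteq> eigenspace u r 0"
    using smooth_finite[OF _ \<open>u \<in> Bs\<close>] Z(1) by (metis finite_insert)
  have "transvection u 0 = id"
    by (simp add: fun_eq_iff transvection_def)
  then obtain \<epsilon>1 where \<epsilon>1: "0 < \<epsilon>1" "\<And>c. v c \<le> \<epsilon>1 \<Longrightarrow> transvection u c \<in> U"
    using V.ball_in_preimage[OF _ UV(1)] continuous_map_transvection[OF T] UV(3) T by metis
  obtain \<epsilon>2 where \<epsilon>2: "0 < \<epsilon>2" "\<And>c. v c \<le> \<epsilon>2 \<Longrightarrow> small r c"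
    using ex_small[OF r(1)] by blast
  define \<epsilon> where "\<epsilon> = min \<epsilon>1 \<epsilon>2"
  have \<epsilon>: "0 < \<epsilon>" "\<And>c. v c \<le> \<epsilon> \<Longrightarrow> small r c"
    using \<epsilon>1 \<epsilon>2 by (auto simp: \<epsilon>_def)
  have "s0 \<in> eigenspace u r 0"
    using r by simp
  then obtain \<delta> where \<delta>: "0 < \<delta>"
    "\<And>s. (\<forall>c M. v c \<le> \<epsilon> \<longrightarrow> transvection_operator u r c M \<longrightarrow> M s = s) \<Longrightarrow> s \<in> eigenspace u \<delta> 0"
    using transvection_invariants[OF r(1) \<epsilon>(1) s0 _ \<epsilon>(2)] by blast
  have "(transvection u c, M) \<in> N" if c: "v c \<le> \<epsilon>" and M: "transvection_operator u r c M" for c M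
  proof -
    have "M z = z" if "z \<in> Z" for z
    proof -
      have "z \<in> eigenspace u r 0"
        using r that by blast
      then have "M z = gauss c u 0 z"
        using M unfolding transvection_operator_def by blast
      then show ?thesis
        by simp
    qed
    moreover have "M \<in> carrier (GL scS)"
      using M by (simp add: GL_def transvection_operator_def)
    ultimately have "M \<in> V"
      using Z by blast
    then show ?thesis
      using transvection_lift[OF rho M] UV(5) \<epsilon>1(2)[of c] c O'(2) by (auto simp: \<epsilon>_def)
  qed
  then have "{s. \<forall>(g, M)\<in>N. M s = s} \<subseteq> eigenspace u \<delta> 0"
    using \<delta>(2) by blast
  then show ?thesis
    using \<delta>(1) by blast
qed

lemma open_invariants_finite_dimensional:
  assumes T: "T = Metric_space.mtopology UNIV (\<lambda>x y. v (x - y))"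
    and rho: "\<And>w t s. \<rho> (w, t) s = scS (\<psi> t) (P w s)"
    and N: "openin (ext_topology (Sp_tilde T scW Bs B scS \<rho>)) N" "(id, id) \<in> N"
  shows "\<exists>Y. finite Y \<and> {s. \<forall>(g, M)\<in>N. M s = s} \<subseteq> S.span Y"
proof (cases "\<exists>s0 :: 's. s0 \<noteq> 0")
  case True
  then obtain s0 :: 's where s0: "s0 \<noteq> 0"
    by blast
  have "\<forall>b\<in>Bs. \<exists>\<delta>. 0 < \<delta> \<and> {s. \<forall>(g, M)\<in>N. M s = s} \<subseteq> eigenspace b \<delta> 0"
    using open_invariants[OF T rho N _ s0] by simp
  from bchoice[OF this] obtain d where d: "\<And>b. b \<in> Bs \<Longrightarrow> 0 < d b"
      "\<And>b. b \<in> Bs \<Longrightarrow> {s. \<forall>(g, M)\<in>N. M s = s} \<subseteq> eigenspace b (d b) 0"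
    by blast
  \<comment> \<open>The inserted 1 covers an empty basis, that is, \<open>W = 0\<close>.\<close>
  define \<delta> where "\<delta> = Min (insert 1 (d ` Bs))"
  have "0 < \<delta>" "\<And>b. b \<in> Bs \<Longrightarrow> \<delta> \<le> d b"
    using d(1) W.finite_Basis by (auto simp: \<delta>_def)
  then have sub: "{s. \<forall>(g, M)\<in>N. M s = s} \<subseteq> {s. \<forall>b\<in>Bs. s \<in> eigenspace b \<delta> 0}"
    using d(2) eigenspace_mono by blast
  obtain Y where Y: "finite Y" "{s. \<forall>b\<in>Bs. s \<in> eigenspace b \<delta> 0} \<subseteq> S.span Y"
    using lattice_invariants_finite_dimensional[OF \<open>0 < \<delta>\<close>] by (elim exE conjE)
  show ?thesis
    by (intro exI[of _ Y] conjI Y(1) subset_trans[OF sub Y(2)])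
next
  case False
  then have "s \<in> S.span {}" for s :: 's
    by simp
  then show ?thesis
    by blast
qed

end

section \<open>From a Heisenberg model to its operators\<close>

lemma continuous_map_line:
  fixes v :: "'f::field \<Rightarrow> real" and scW :: "'f \<Rightarrow> 'w::ab_group_add \<Rightarrow> 'w"
  assumes "nonarch_abs v" and T: "T = Metric_space.mtopology UNIV (\<lambda>x y. v (x - y))"
    and "finite_dimensional_vector_space scW Bs" and "u \<in> Bs"
  shows "continuous_map T (space_topology T scW Bs) (\<lambda>x. scW x u)"
  unfolding space_topology_def
proof (rule continuous_map_pullback')
  interpret V: nonarch_abs v
    by fact
  interpret W: finite_dimensional_vector_space scW Bs
    by fact
  have "continuous_map T T (\<lambda>x. W.representation Bs (scW x u) b)" for b
    using V.continuous_map_affine[of 0 "W.representation Bs u b"]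
    by (simp add: T W.representation_scale W.independent_Basis W.span_Basis)
  then show "continuous_map T (product_topology (\<lambda>_. T) Bs)
      ((\<lambda>w. \<lambda>b\<in>Bs. W.representation Bs w b) \<circ> (\<lambda>x. scW x u))"
    by (simp add: continuous_map_componentwise o_def image_subset_iff)
qed simp

lemma heisenberg_model_mult:
  assumes "heisenberg_model T scW Bs B \<psi> scS \<rho>"
  shows "\<rho> (w, t) (\<rho> (w', t') s) = \<rho> (w + w', t + t' + B w w' / 2) s"
proof -
  have "\<rho> \<in> hom (heisenberg_group B) (GL scS)"
    using assms by (simp add: heisenberg_model_def representation_def)
  from hom_mult[OF this, of "(w, t)" "(w', t')"] show ?thesis
    by (simp add: heisenberg_group_def GL_def fun_eq_iff)
qed

lemma heisenberg_model_operators: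
  assumes v: "nonarch_abs v" and T: "T = Metric_space.mtopology UNIV (\<lambda>x y. v (x - y))"
    and cov: "\<forall>r>0. \<forall>R. \<exists>X. finite X \<and> (\<forall>x. v x \<le> R \<longrightarrow> (\<exists>y\<in>X. v (x - y) \<le> r))"
    and char: "CHAR('f::field) \<noteq> 2"
    and W: "finite_dimensional_vector_space scW Bs" and form: "symplectic_form scW B"
    and psi: "smooth_character T \<psi>" "\<exists>t. \<psi> t \<noteq> 1"
    and model: "heisenberg_model T scW Bs B (\<psi> :: 'f \<Rightarrow> 'r::field) scS \<rho>"
  shows "heisenberg_operators v scW Bs scS B \<psi> (\<lambda>w. \<rho> (w, 0))"
    and "\<rho> (w, t) s = scS (\<psi> t) (\<rho> (w, 0) s)"
proof -
  interpret V: nonarch_abs v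
    by (rule v)
  interpret W: finite_dimensional_vector_space scW Bs
    by (rule W)
  interpret S: vector_space scS
    using model by (simp add: heisenberg_model_def representation_def)
  have B_zero: "B 0 w = 0" for w
  proof -
    interpret Vector_Spaces.linear scW "(*)" "\<lambda>w'. B w' w"
      using form by (simp add: symplectic_form_def)
    show ?thesis
      by (rule zero)
  qed
  have psi_hom: "\<psi> \<in> hom additive_group multiplicative_group"
    using psi(1) by (simp add: smooth_character_def)
  have psi_add: "\<psi> (x + y) = \<psi> x * \<psi> y" for x y
    using hom_mult[OF psi_hom, of x y] by (simp add: additive_group_def multiplicative_group_def)
  have psi_nonzero: "\<psi> x \<noteq> 0" for x
    using hom_in_carrier[OF psi_hom, of x] by (simp add: additive_group_def multiplicative_group_def)
  have psi_zero: "\<psi> 0 = 1"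
    using psi_add[of 0 0] psi_nonzero[of 0] by simp
  have center: "\<rho> (0, t) s = scS (\<psi> t) s" for t s
    using model by (simp add: heisenberg_model_def)
  show rho: "\<rho> (w, t) s = scS (\<psi> t) (\<rho> (w, 0) s)" for w t s
    using heisenberg_model_mult[OF model, of 0 t w 0 s] by (simp add: B_zero center)
  have lin: "Vector_Spaces.linear scS scS (\<rho> h)" for h
  proof -
    have "\<rho> h \<in> carrier (GL scS)"
      using model by (intro hom_in_carrier[of \<rho> "heisenberg_group B"])
        (simp_all add: heisenberg_model_def representation_def heisenberg_group_def)
    then show ?thesis
      by (simp add: GL_def)
  qed
  \<comment> \<open>Otherwise the characteristic would divide 2 without being 2, hence be 1, which
    is impossible in a field.\<close>
  have two: "(2::'f) \<noteq> 0"
  proof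
    assume "(2::'f) = 0"
    then have "CHAR('f) dvd 2"
      using of_nat_eq_0_iff_char_dvd[where 'a = 'f, of 2] by simp
    then have "CHAR('f) = 1"
      using char by (metis CHAR_not_1' dvd_imp_le le_antisym prime_nat_iff two_is_prime_nat)
    then show False
      by simp
  qed
  have psi_ball: "\<exists>d>0. \<forall>x. v x \<le> d \<longrightarrow> \<psi> x = 1"
  proof -
    have "openin (Metric_space.mtopology UNIV (\<lambda>x y. v (x - y))) {t. \<psi> t = 1}"
      using psi(1) by (simp add: smooth_character_def T)
    then show ?thesis
      unfolding V.openin_mtopology_iff using psi_zero by force
  qed
  \<comment> \<open>The centre acts by scalars, so a subspace stable under all
    \<open>\<rho> (w, 0)\<close> is stable under the whole group.\<close>
  have irreducible: "U = {0} \<or> U = UNIV"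
    if "S.subspace U" "\<And>w. \<rho> (w, 0) ` U \<subseteq> U" for U
  proof -
    have "\<rho> h ` U \<subseteq> U" for h
    proof (cases h)
      case (Pair w t)
      have "\<rho> (w, t) s \<in> U" if "s \<in> U" for s
        using that \<open>\<And>w. \<rho> (w, 0) ` U \<subseteq> U\<close> S.subspace_scale[OF \<open>S.subspace U\<close>] rho[of w t s] by auto
      then show ?thesis
        using Pair by blast
    qed
    then show ?thesis
      using model that(1) unfolding heisenberg_model_def irreducible_rep_def by blast
  qed
  have smooth: "\<exists>r>0. \<forall>x. v x \<le> r \<longrightarrow> \<rho> (scW x b, 0) s = s" if b: "b \<in> Bs" for b s
  proof -
    have "openin (prod_topology (space_topology T scW Bs) T) {h. \<rho> h s = s}"
      using model by (simp add: heisenberg_model_def smooth_rep_def heisenberg_topology_def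
          heisenberg_group_def)
    moreover have "(0, 0) \<in> {h. \<rho> h s = s}"
      by (simp add: center psi_zero)
    ultimately obtain U U' where U: "openin (space_topology T scW Bs) U" "0 \<in> U" "0 \<in> U'"
        "U \<times> U' \<subseteq> {h. \<rho> h s = s}"
      unfolding openin_prod_topology_alt by blast
    obtain r where "0 < r" "\<And>x. v x \<le> r \<Longrightarrow> scW x b \<in> U"
      using V.ball_in_preimage[OF continuous_map_line[OF v T W b, unfolded T] U(1)[unfolded T]] U(2)
      by auto
    then show ?thesis
      using U by blast
  qed
  have covering: "\<exists>X. finite X \<and> (\<forall>x. v x \<le> R \<longrightarrow> (\<exists>y\<in>X. v (x - y) \<le> r))" if "0 < r" for r R
    using cov that by simp
  have P_zero: "\<rho> (0, 0) s = s" for s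
    by (simp add: center psi_zero)
  have P_mult: "\<rho> (w, 0) (\<rho> (w', 0) s) = scS (\<psi> (B w w' / 2)) (\<rho> (w + w', 0) s)" for w w' s
    using heisenberg_model_mult[OF model, of w 0 w' 0 s] rho[of "w + w'" "B w w' / 2" s] by simp
  show "heisenberg_operators v scW Bs scS B \<psi> (\<lambda>w. \<rho> (w, 0))"
    by (intro heisenberg_operators.intro heisenberg_operators_axioms.intro)
      (fact v W S.vector_space_axioms covering two form psi_add psi_nonzero psi_ball psi(2) lin P_zero
        P_mult irreducible smooth)+
qed

theorem proposition3p20:
  fixes p :: nat
    and T :: "'f::field topology"
    and scW :: "'f \<Rightarrow> 'w::ab_group_add \<Rightarrow> 'w"
    and Bs :: "'w set"
    and B :: "'w \<Rightarrow> 'w \<Rightarrow> 'f"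
    and \<psi> :: "'f \<Rightarrow> 'r::field"
    and scS :: "'r \<Rightarrow> 's::ab_group_add \<Rightarrow> 's"
    and \<rho> :: "'w \<times> 'f \<Rightarrow> 's \<Rightarrow> 's"
    and Mp :: "('r, 'm, 'w \<Rightarrow> 'w) extension"
    and \<phi> :: "'m \<Rightarrow> ('w \<Rightarrow> 'w) \<times> ('s \<Rightarrow> 's)"
    and scV :: "'r \<Rightarrow> 'v::ab_group_add \<Rightarrow> 'v"
    and \<pi> :: "'m \<Rightarrow> 'v \<Rightarrow> 'v"
  assumes "finite_or_local_field p T" and "CHAR('f) \<noteq> 2"
    and "finite_dimensional_vector_space scW Bs" and "symplectic_form scW B"
    and "smooth_character T \<psi>" and "\<exists>t. \<psi> t \<noteq> 1"
    and "heisenberg_model T scW Bs B \<psi> scS \<rho>"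
    and "metaplectic_group T scW Bs B scS \<rho> Mp \<phi>"
    and "weil_representation Mp \<phi> scS scV \<pi>"
  shows "smooth_rep Mp (ext_topology Mp) \<pi> \<and> admissible_rep Mp (ext_topology Mp) scV \<pi>"
proof -
  let ?Sp = "Sp_tilde T scW Bs B scS \<rho>"
  obtain v where abs: "nonarch_abs v \<and> T = Metric_space.mtopology UNIV (\<lambda>x y. v (x - y)) \<and>
    (\<forall>r>0. \<forall>R. \<exists>X. finite X \<and> (\<forall>x. v x \<le> R \<longrightarrow> (\<exists>y\<in>X. v (x - y) \<le> r)))"
    using finite_or_local_field_abs[OF assms(1)] ..
  then have v: "nonarch_abs v" "T = Metric_space.mtopology UNIV (\<lambda>x y. v (x - y))"
    "\<forall>r>0. \<forall>R. \<exists>X. finite X \<and> (\<forall>x. v x \<le> R \<longrightarrow> (\<exists>y\<in>X. v (x - y) \<le> r))"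
    by simp_all
  note H = heisenberg_model_operators[OF v assms(2-7)]
  interpret H: heisenberg_operators v scW Bs scS B \<psi> "\<lambda>w. \<rho> (w, 0)"
    by (rule H(1))
  have "group Mp" and topspace: "topspace (ext_topology Mp) = carrier Mp"
    and iso: "\<phi> \<in> iso Mp ?Sp"
    and homeo: "homeomorphic_map (ext_topology Mp) (ext_topology ?Sp) \<phi>"
    using assms(8) by (simp_all add: metaplectic_group_def topological_group_def extension_iso_def)
  interpret Mp: group Mp
    by (rule \<open>group Mp\<close>)
  obtain f where f: "Vector_Spaces.linear scS scV f" "bij f"
      "\<And>g s. g \<in> carrier Mp \<Longrightarrow> f (snd (\<phi> g) s) = \<pi> g (f s)"
    using assms(9) by (auto simp: weil_representation_def representation_iso_def omega_def)
  interpret f: Vector_Spaces.linear scS scV f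
    by (rule f)
  \<comment> \<open>Injectivity of \<open>f\<close> lets both claims be settled in the model
    \<open>S\<close>.\<close>
  have fixed_iff: "\<pi> g (f s) = f s \<longleftrightarrow> snd (\<phi> g) s = s" if "g \<in> carrier Mp" for g s
    using f(2,3) that by (metis bij_is_inj injD)
  have carrier: "\<phi> g \<in> Sp_tilde_carrier scW B scS \<rho>" if "g \<in> carrier Mp" for g
    using iso that hom_in_carrier[of \<phi> Mp ?Sp] by (simp add: iso_def Sp_tilde_def)
  have GL: "snd (\<phi> g) \<in> carrier (GL scS)" if "g \<in> carrier Mp" for g
    using carrier[OF that] by (auto simp: Sp_tilde_carrier_def)
  have "smooth_rep Mp (ext_topology Mp) \<pi>"
    unfolding smooth_rep_def
  proof
    fix x
    obtain s where s: "x = f s"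
      using f(2) by (metis bij_pointE)
    \<comment> \<open>A singleton is compact and open in a discrete space, so fixing
      \<open>s\<close> is a subbasic condition.\<close>
    have "openin (GL_topology scS) {M \<in> carrier (GL scS). M ` {s} \<subseteq> {s}}"
      unfolding GL_topology_def compact_open_topology_def
      by (intro topology_generated_by_Basis CollectI exI[of _ "{s}"])
        (simp add: compactin_discrete_topology)
    then have "openin (ext_topology ?Sp) ((topspace (Sp_topology T scW Bs B) \<times>
        {M \<in> carrier (GL scS). M ` {s} \<subseteq> {s}}) \<inter> Sp_tilde_carrier scW B scS \<rho>)"
      by (auto simp: Sp_tilde_def openin_prod_Times_iff intro!: openin_subtopology_Int)
    from openin_continuous_map_preimage[OF homeomorphic_imp_continuous_map[OF homeo] this]
    have "openin (ext_topology Mp) {g \<in> carrier Mp. \<phi> g \<in> (topspace (Sp_topology T scW Bs B) \<times>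
        {M \<in> carrier (GL scS). M ` {s} \<subseteq> {s}}) \<inter> Sp_tilde_carrier scW B scS \<rho>}"
      by (simp add: topspace)
    also have "{g \<in> carrier Mp. \<phi> g \<in> (topspace (Sp_topology T scW Bs B) \<times>
        {M \<in> carrier (GL scS). M ` {s} \<subseteq> {s}}) \<inter> Sp_tilde_carrier scW B scS \<rho>} =
        {g \<in> carrier Mp. \<pi> g x = x}"
    proof -
      have "\<phi> g \<in> topspace (ext_topology ?Sp)" if "g \<in> carrier Mp" for g
        using homeo that topspace by (metis homeomorphic_imp_surjective_map imageI)
      then have "fst (\<phi> g) \<in> topspace (Sp_topology T scW Bs B)" if "g \<in> carrier Mp" for g
        using that by (fastforce simp: Sp_tilde_def)
      then show ?thesis
        using fixed_iff carrier GL by (auto simp: s mem_Times_iff)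
    qed
    finally show "openin (ext_topology Mp) {g \<in> carrier Mp. \<pi> g x = x}" .
  qed
  moreover have "admissible_rep Mp (ext_topology Mp) scV \<pi>"
    unfolding admissible_rep_def
  proof (intro allI impI, elim conjE)
    fix K
    assume K: "subgroup K Mp" "openin (ext_topology Mp) K"
    define U where "U = {s. \<forall>(g, M)\<in>\<phi> ` K. M s = s}"
    have K_carrier: "K \<subseteq> carrier Mp"
      using K(1) by (rule subgroup.subset)
    have image_open: "openin (ext_topology ?Sp) (\<phi> ` K)"
      using homeomorphic_imp_open_map[OF homeo] K(2) by (simp add: open_map_def)
    have image_id: "(id, id) \<in> \<phi> ` K"
    proof -
      have "\<one>\<^bsub>Mp\<^esub> \<in> K"
        using K(1) by (rule subgroup.one_closed)
      \<comment> \<open>Both components of the image of the unit are idempotent and injective, hence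
        identities.\<close>
      moreover have "\<phi> \<one>\<^bsub>Mp\<^esub> = (id, id)"
      proof -
        obtain g M where gM: "\<phi> \<one>\<^bsub>Mp\<^esub> = (g, M)"
          by fastforce
        have "\<phi> (\<one>\<^bsub>Mp\<^esub> \<otimes>\<^bsub>Mp\<^esub> \<one>\<^bsub>Mp\<^esub>) = \<phi> \<one>\<^bsub>Mp\<^esub> \<otimes>\<^bsub>?Sp\<^esub> \<phi> \<one>\<^bsub>Mp\<^esub>"
          using iso by (intro hom_mult[of \<phi> Mp ?Sp]) (simp_all add: iso_def)
        then have "g \<circ> g = g" "M \<circ> M = M"
          by (simp_all add: gM Sp_tilde_def Sp_def GL_def)
        moreover have "inj g" "inj M"
          using carrier[of "\<one>\<^bsub>Mp\<^esub>"] gM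
          by (auto simp: Sp_tilde_carrier_def Sp_def GL_def bij_is_inj)
        ultimately show ?thesis
          unfolding gM by (auto simp: fun_eq_iff inj_eq)
      qed
      ultimately show ?thesis
        by force
    qed
    obtain Y where Y: "finite Y" "U \<subseteq> H.S.span Y"
      using H.open_invariants_finite_dimensional[OF v(2) H(2) image_open image_id]
      unfolding U_def by (elim exE conjE)
    have "H.S.subspace U"
    proof (rule H.S.subspaceI)
      have lin: "M 0 = 0" "M (x + y) = M x + M y" "M (scS c x) = scS c (M x)"
        if "(g, M) \<in> \<phi> ` K" for g M x y c
      proof -
        obtain k where "k \<in> carrier Mp" "\<phi> k = (g, M)"
          using \<open>(g, M) \<in> \<phi> ` K\<close> K_carrier by auto
        then interpret M: Vector_Spaces.linear scS scS M
          using GL[of k] by (simp add: GL_def)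
        show "M 0 = 0" "M (x + y) = M x + M y" "M (scS c x) = scS c (M x)"
          by (rule M.zero M.add M.scale)+
      qed
      show "0 \<in> U"
        using lin(1) unfolding U_def by blast
      show "x + y \<in> U" if "x \<in> U" "y \<in> U" for x y
        using that lin(2) unfolding U_def by fastforce
      show "scS c x \<in> U" if "x \<in> U" for c x
        using that lin(3) unfolding U_def by fastforce
    qed
    then obtain X where X: "finite X" "H.S.span X = U"
      using H.S.finite_spanning_subset[OF _ Y] by blast
    have "invariants K \<pi> = f ` U"
    proof -
      have mem: "f s \<in> invariants K \<pi> \<longleftrightarrow> s \<in> U" for s
      proof -
        have "f s \<in> invariants K \<pi> \<longleftrightarrow> (\<forall>k\<in>K. \<pi> k (f s) = f s)"
          by (simp add: invariants_def)
        also have "\<dots> \<longleftrightarrow> (\<forall>k\<in>K. snd (\<phi> k) s = s)"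
          using fixed_iff K_carrier by blast
        also have "\<dots> \<longleftrightarrow> s \<in> U"
          by (simp add: U_def case_prod_beta)
        finally show ?thesis .
      qed
      have "x \<in> invariants K \<pi> \<longleftrightarrow> x \<in> f ` U" for x
      proof -
        obtain s where "x = f s"
          using f(2) by (metis bij_pointE)
        then show ?thesis
          by (simp add: mem inj_image_mem_iff[OF bij_is_inj[OF f(2)]])
      qed
      then show ?thesis
        by blast
    qed
    then have "f.vs2.span (f ` X) = invariants K \<pi>"
      using X by (simp add: f.span_image)
    then show "\<exists>X. finite X \<and> module.span scV X = invariants K \<pi>"
      using X(1) by blast
  qed
  ultimately show ?thesis
    by blast
qed

end
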